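(* Let $X,Y,A,B$ be formal variables. Define the sequences $$g_n = BY\left[(1+AY)^n + (AY)^n\,(Y^{-2}-1)\right],\qquad h_n=(AY)^{n-1}\qquad (n\ge 1),$$ let $\hat g_n=\sum_{\sigma\in \mathrm{NC}(n)}\prod_{c\in\sigma} g_{|c|}$ (product over the blocks $c$ of $\sigma$), $\hat g(X)=\sum_{n\ge1}\hat g_nX^n$ and $h(X)=\sum_{n\ge1}h_nX^n$. Let $$K(X,Y,A,B)=\sum_{n=1}^\infty X^n \sum_{\substack{\alpha\in \mathrm{KrInt}(n),\ \beta\in \mathrm{NC}(n)\\ \alpha\wedge_{\mathrm{KrInt}}\beta=0_n}} Y^{\|\alpha^{-1}\beta\|}A^{\|\alpha^{-1}\gamma_n\|}B^{\|\beta^{-1}\gamma_n\|}.$$ Then, as formal power series in $X$, $$K(X,Y,A,B)=h\big(X(1+\hat g(X))\big)=\sum_{s=1}^\infty h_sX^s\big(1+\hat g(X)\big)^s ,$$ and the generating function of meandric systems with shallow top, $$M(X,Y,A,B)=\sum_{n=1}^\infty X^n\sum_{\alpha\in\mathrm{Int}(n),\ \beta\in\mathrm{NC}(n)}Y^{\|\alpha^{-1}\beta\|}A^{\|\alpha\|}B^{\|\beta\|},$$ satisfies $M=\dfrac{K}{1-K}$.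
   Context: $\mathcal S_n$ is the symmetric group on $[n]=\{1,\dots,n\}$; $\#\alpha$ is the number of cycles of $\alpha\in\mathcal S_n$ and $\|\alpha\|=n-\#\alpha$ its length (minimal number of transpositions). $\gamma_n=(1\,2\,\cdots\,n)$ is the full cycle, also denoted $1_n$, and $0_n$ is the identity permutation. A partition of $[n]$ is non-crossing if there are no distinct blocks $B_i,B_j$ and $a,b\in B_i$, $c,d\in B_j$ with $a<c<b<d$; $\mathrm{NC}(n)$ is the set of non-crossing partitions of $[n]$, and each is identified with the permutation whose cycles are its blocks, each cycle listing its elements in increasing order. $\mathrm{Int}(n)\subseteq\mathrm{NC}(n)$ is the set of interval partitions (every block consists of consecutive integers). $\mathrm{NC}(n)$ is partially ordered by $\rho\le\sigma$ iff every block of $\rho$ is contained in a block of $\sigma$. The Kreweras complement of $\alpha\in\mathrm{NC}(n)$ is the permutation $\alpha^{\mathrm{Kr}}=\alpha^{-1}\gamma_n$, which again belongs to $\mathrm{NC}(n)$; $\mathrm{KrInt}(n)=\{\alpha^{\mathrm{Kr}}:\alpha\in\mathrm{Int}(n)\}$. For $\alpha,\beta\in\mathrm{NC}(n)$, $\alpha\wedge_{\mathrm{KrInt}}\beta=\max\{\rho\in\mathrm{KrInt}(n):\rho\le\alpha,\ \rho\le\beta\}$. *)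

theory Defs
  imports
    "HOL-Library.Disjoint_Sets"
    "HOL-Combinatorics.Cycles"
    "HOL-Combinatorics.Orbits"
    "HOL-Computational_Algebra.Fraction_Field"
    "HOL-Computational_Algebra.Polynomial"
    "HOL-Computational_Algebra.Formal_Power_Series"
begin

(* Elements of the symmetric group on [n] are functions nat => nat that permute {1..n} (and fix
   every other number). Products are composed right to left, so alpha^{-1} beta is
   inv alpha o beta. *)

definition perm_cycles :: "nat \<Rightarrow> (nat \<Rightarrow> nat) \<Rightarrow> nat set set" where
  "perm_cycles n \<alpha> = orbit \<alpha> ` {1..n}"

definition perm_length :: "nat \<Rightarrow> (nat \<Rightarrow> nat) \<Rightarrow> nat" where
  "perm_length n \<alpha> = n - card (perm_cycles n \<alpha>)"

definition full_cycle :: "nat \<Rightarrow> nat \<Rightarrow> nat" where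
  "full_cycle n = cycle_of_list [1..<Suc n]"

definition noncrossing :: "nat set set \<Rightarrow> bool" where
  "noncrossing P \<longleftrightarrow>
     \<not> (\<exists>B\<in>P. \<exists>C\<in>P. B \<noteq> C \<and>
          (\<exists>a\<in>B. \<exists>b\<in>B. \<exists>c\<in>C. \<exists>d\<in>C. a < c \<and> c < b \<and> b < d))"

definition noncrossing_partitions :: "nat \<Rightarrow> nat set set set" where
  "noncrossing_partitions n = {P. partition_on {1..n} P \<and> noncrossing P}"

definition interval_partitions :: "nat \<Rightarrow> nat set set set" where
  "interval_partitions n = {P. partition_on {1..n} P \<and> (\<forall>B\<in>P. \<exists>a b. B = {a..b})}"

definition perm_of_partition :: "nat set set \<Rightarrow> nat \<Rightarrow> nat" where
  "perm_of_partition P x =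
     (if x \<in> \<Union>P then cycle_of_list (sorted_list_of_set (THE B. B \<in> P \<and> x \<in> B)) x else x)"

(* Partitions are identified with their permutations: NC, Int_part and KrInt below are sets of
   permutations, and the blocks of such a permutation are its cycles. *)

definition NC :: "nat \<Rightarrow> (nat \<Rightarrow> nat) set" where
  "NC n = perm_of_partition ` noncrossing_partitions n"

definition Int_part :: "nat \<Rightarrow> (nat \<Rightarrow> nat) set" where
  "Int_part n = perm_of_partition ` interval_partitions n"

definition kreweras :: "nat \<Rightarrow> (nat \<Rightarrow> nat) \<Rightarrow> nat \<Rightarrow> nat" where
  "kreweras n \<alpha> = inv \<alpha> \<circ> full_cycle n"

definition KrInt :: "nat \<Rightarrow> (nat \<Rightarrow> nat) set" where
  "KrInt n = kreweras n ` Int_part n"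

definition refines :: "nat \<Rightarrow> (nat \<Rightarrow> nat) \<Rightarrow> (nat \<Rightarrow> nat) \<Rightarrow> bool" where
  "refines n \<rho> \<sigma> \<longleftrightarrow> (\<forall>B\<in>perm_cycles n \<rho>. \<exists>C\<in>perm_cycles n \<sigma>. B \<subseteq> C)"

(* The greatest element, with respect to refinement, of the set of common lower bounds in KrInt. *)
definition KrInt_meet :: "nat \<Rightarrow> (nat \<Rightarrow> nat) \<Rightarrow> (nat \<Rightarrow> nat) \<Rightarrow> nat \<Rightarrow> nat" where
  "KrInt_meet n \<alpha> \<beta> =
     (let S = {\<rho> \<in> KrInt n. refines n \<rho> \<alpha> \<and> refines n \<rho> \<beta>}
      in THE \<rho>. \<rho> \<in> S \<and> (\<forall>\<tau>\<in>S. refines n \<tau> \<rho>))"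

(* The coefficient field is Q(Y, A, B), the fraction field of Q[Y][A][B], because g_n is written
   with Y^{-2}. Its generators Y, A, B are Yv, Av, Bv; the remaining variable X is fps_X. *)

type_synonym coeff = "rat poly poly poly fract"

definition Yv :: coeff where "Yv = Fraction_Field.Fract [:[:[:0, 1:]:]:] 1"
definition Av :: coeff where "Av = Fraction_Field.Fract [:[:0, 1:]:] 1"
definition Bv :: coeff where "Bv = Fraction_Field.Fract [:0, 1:] 1"

definition g_seq :: "nat \<Rightarrow> coeff" where
  "g_seq n = Bv * Yv * ((1 + Av * Yv) ^ n + (Av * Yv) ^ n * (inverse (Yv ^ 2) - 1))"

definition h_seq :: "nat \<Rightarrow> coeff" where
  "h_seq n = (Av * Yv) ^ (n - 1)"

definition g_hat :: "nat \<Rightarrow> coeff" where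
  "g_hat n = (\<Sum>\<sigma>\<in>NC n. \<Prod>c\<in>perm_cycles n \<sigma>. g_seq (card c))"

definition g_hat_series :: "coeff fps" where
  "g_hat_series = Abs_fps (\<lambda>n. if n = 0 then 0 else g_hat n)"

definition h_series :: "coeff fps" where
  "h_series = Abs_fps (\<lambda>n. if n = 0 then 0 else h_seq n)"

definition K_series :: "coeff fps" where
  "K_series = Abs_fps (\<lambda>n. if n = 0 then 0 else
     (\<Sum>(\<alpha>, \<beta>) \<in> {(\<alpha>, \<beta>). \<alpha> \<in> KrInt n \<and> \<beta> \<in> NC n \<and> KrInt_meet n \<alpha> \<beta> = id}.
        Yv ^ perm_length n (inv \<alpha> \<circ> \<beta>)
        * Av ^ perm_length n (inv \<alpha> \<circ> full_cycle n)
        * Bv ^ perm_length n (inv \<beta> \<circ> full_cycle n)))"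

definition M_series :: "coeff fps" where
  "M_series = Abs_fps (\<lambda>n. if n = 0 then 0 else
     (\<Sum>(\<alpha>, \<beta>) \<in> Int_part n \<times> NC n.
        Yv ^ perm_length n (inv \<alpha> \<circ> \<beta>) * Av ^ perm_length n \<alpha> * Bv ^ perm_length n \<beta>))"

end

theory Submission
  imports Defs
begin

text \<open>
  The complement of an interval partition is a single cycle on a set \<open>S\<close> containing \<open>n\<close>, and the
  meet of this cycle with \<open>\<beta>\<close> is the cycle on the intersection of \<open>S\<close> with the block \<open>V\<close> of
  \<open>\<beta>\<close> containing \<open>n\<close>. The number of cycles of \<open>\<alpha>\<^sup>-\<^sup>1 \<beta>\<close> is \<open>|S| + 1 + 2 d - #\<beta>\<close>, where
  \<open>d\<close> counts the blocks of \<open>\<beta>\<close> disjoint from \<open>S\<close>. Hence the weight of \<open>(S, \<beta>)\<close> is a product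
  over the blocks \<open>c\<close> of \<open>\<beta>\<close> of a factor depending only on \<open>S \<inter> c\<close>: summing over \<open>S\<close> turns
  each block \<open>c \<noteq> V\<close> into \<open>g\<^bsub>|c|\<^esub>\<close>, and \<open>V\<close> into \<open>(A Y)\<^bsup>|V| - 1\<^esup>\<close> when
  \<open>S \<inter> V = {n}\<close> is required and into \<open>(1 + A Y)\<^bsup>|V| - 1\<^esup>\<close> otherwise. Kreweras complementation
  on both sides identifies the latter case with the coefficients of \<open>M\<close>.
  Cutting \<open>\<beta>\<close> along \<open>V\<close> leaves independent non-crossing partitions in the \<open>|V|\<close> gaps, so
  with \<open>u = X (1 + G)\<close> and \<open>G\<close> the series of the numbers \<open>g_hat n\<close>, one gets
  \<open>K (1 - A Y u) = u\<close> and \<open>M (1 - (1 + A Y) u) = u\<close>.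
\<close>

subsection \<open>Cycles of permutations\<close>

text \<open>The obstacle is the exponent of Y: the cycles of
  \<open>inv \<alpha> \<circ> \<beta>\<close> have no convenient description, so they are counted
  without being described. The count makes the exponent (n - |S|) + (#\<beta> - 1) - 2 d, and its
  last term is the origin of Y^{-2} in g_n. The exponents of A and B are n - |S| and #\<beta> - 1,
  so a point outside S costs AY and a block other than V costs BY. Membership in \<open>NC n\<close>
  is tested on values instead of blocks: a permutation of [n] belongs to it iff it maps
  \<open>{\<sigma> x..x}\<close> into itself whenever \<sigma> x \<le> x. Complements pass this test
  although their blocks remain unknown. The relation between M and K does not come from decomposing
  meandric systems. It is algebra: 1 - (1 + AY) u = (1 - AY u) - u.\<close>

lemma permutes_permutation: "\<sigma> permutes {1..n} \<Longrightarrow> permutation \<sigma>" for n :: nat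
  by (metis finite_atLeastAtMost permutation_permutes)

lemma mem_orbit_self: "\<sigma> permutes {1..n} \<Longrightarrow> x \<in> orbit \<sigma> x" for n :: nat
  by (simp add: permutation_self_in_orbit permutes_permutation)

lemma orbit_eqI_mem: "\<sigma> permutes {1..n} \<Longrightarrow> y \<in> orbit \<sigma> x \<Longrightarrow> orbit \<sigma> y = orbit \<sigma> x" for n :: nat
  by (metis cyclic_on_orbit' orbit_cyclic_eq3 permutes_permutation)

lemma orbit_subset_atLeastAtMost: "\<sigma> permutes {1..n} \<Longrightarrow> x \<in> {1..n} \<Longrightarrow> orbit \<sigma> x \<subseteq> {1..n}" for n :: nat
  by (rule permutes_orbit_subset)

lemma orbit_subset_invariant:
  assumes "x \<in> A" "\<And>z. z \<in> A \<Longrightarrow> f z \<in> A"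
  shows "orbit f x \<subseteq> A"
proof
  fix y assume "y \<in> orbit f x"
  then show "y \<in> A" by induction (use assms in auto)
qed

lemma partition_on_perm_cycles:
  assumes "\<sigma> permutes {1..n}"
  shows "partition_on {1..n} (perm_cycles n \<sigma>)"
proof (rule partition_onI)
  show "\<Union>(perm_cycles n \<sigma>) = {1..n}"
    using orbit_subset_atLeastAtMost[OF assms] mem_orbit_self[OF assms]
    unfolding perm_cycles_def by blast
  show "{} \<notin> perm_cycles n \<sigma>"
    unfolding perm_cycles_def using mem_orbit_self[OF assms] by blast
  fix p q assume "p \<in> perm_cycles n \<sigma>" "q \<in> perm_cycles n \<sigma>" "p \<noteq> q"
  then obtain x y where "p = orbit \<sigma> x" "q = orbit \<sigma> y" "orbit \<sigma> x \<noteq> orbit \<sigma> y"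
    by (auto simp: perm_cycles_def)
  then show "disjnt p q"
    unfolding disjnt_iff using orbit_eqI_mem[OF assms] by metis
qed

lemma finite_perm_cycles [simp]: "finite (perm_cycles n \<sigma>)"
  by (simp add: perm_cycles_def)

lemma card_perm_cycles_le: "card (perm_cycles n \<sigma>) \<le> n"
  unfolding perm_cycles_def using card_image_le[of "{1..n}" "orbit \<sigma>"] by simp

lemma perm_cycles_inv: "\<sigma> permutes {1..n} \<Longrightarrow> perm_cycles n (inv \<sigma>) = perm_cycles n \<sigma>"
  by (simp add: perm_cycles_def orbit_inv_eq permutes_permutation)

text \<open>\<tau> carries the cycle of \<sigma> through x onto the cycle of the conjugate through
  \<tau> x, and being injective it keeps distinct cycles distinct.\<close>

lemma card_perm_cycles_conj:
  assumes "\<sigma> permutes {1..n}" "\<tau> permutes {1..n}"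
  shows "card (perm_cycles n (\<tau> \<circ> \<sigma> \<circ> inv \<tau>)) = card (perm_cycles n \<sigma>)"
proof -
  have orb: "orbit (\<tau> \<circ> \<sigma> \<circ> inv \<tau>) (\<tau> x) = \<tau> ` orbit \<sigma> x" for x
    using orbit_inverse[of x \<sigma> "\<tau> \<circ> \<sigma> \<circ> inv \<tau>" \<tau>] mem_orbit_self[OF assms(1)]
    by (simp add: permutes_inverses(2)[OF assms(2)])
  have "perm_cycles n (\<tau> \<circ> \<sigma> \<circ> inv \<tau>) = orbit (\<tau> \<circ> \<sigma> \<circ> inv \<tau>) ` \<tau> ` {1..n}"
    by (simp only: perm_cycles_def permutes_image[OF assms(2)])
  also have "\<dots> = (`) \<tau> ` perm_cycles n \<sigma>"
    by (simp only: perm_cycles_def image_image orb)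
  finally show ?thesis
    using permutes_inj[OF assms(2)] by (simp add: card_image inj_on_def inj_image_eq_iff)
qed

section \<open>Left multiplication by a transposition\<close>

lemma perm_cycles_avoiding_transpose:
  assumes "C \<in> perm_cycles n \<sigma>" "a \<notin> C" "b \<notin> C" "\<sigma> permutes {1..n}"
  shows "C \<in> perm_cycles n (transpose a b \<circ> \<sigma>)"
proof -
  obtain x where x: "x \<in> {1..n}" "C = orbit \<sigma> x"
    using assms(1) by (auto simp: perm_cycles_def)
  have "orbit (transpose a b \<circ> \<sigma>) x = orbit \<sigma> x"
  proof (rule orbit_cong)
    show "x \<in> orbit \<sigma> x" using mem_orbit_self[OF assms(4)] .
    fix s assume "s \<in> orbit \<sigma> x"
    then have "\<sigma> s \<in> C" by (simp add: x orbit.step)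
    then show "(transpose a b \<circ> \<sigma>) s = \<sigma> s"
      using assms(2,3) by (auto simp: transpose_def)
  qed
  then show ?thesis using x by (auto simp: perm_cycles_def)
qed

text \<open>Every change is confined to the cycles through a and b, and R collects the others. On
  either side the two displayed orbits may coincide, so splitting and merging are covered at
  once.\<close>

lemma perm_cycles_transpose:
  assumes "\<sigma> permutes {1..n}" "a \<in> {1..n}" "b \<in> {1..n}"
  obtains R where "finite R" "\<forall>C\<in>R. a \<notin> C \<and> b \<notin> C"
    "perm_cycles n \<sigma> = R \<union> {orbit \<sigma> a, orbit \<sigma> b}"
    "perm_cycles n (transpose a b \<circ> \<sigma>) =
      R \<union> {orbit (transpose a b \<circ> \<sigma>) a, orbit (transpose a b \<circ> \<sigma>) b}"
proof -
  let ?\<tau> = "transpose a b \<circ> \<sigma>"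
  have \<tau>: "?\<tau> permutes {1..n}"
    using assms by (intro permutes_compose permutes_swap_id)
  have \<sigma>: "transpose a b \<circ> ?\<tau> = \<sigma>" by (simp add: fun_eq_iff)
  define R where "R = {C \<in> perm_cycles n \<sigma>. a \<notin> C \<and> b \<notin> C}"
  have split: "perm_cycles n \<rho> = {C \<in> perm_cycles n \<rho>. a \<notin> C \<and> b \<notin> C} \<union> {orbit \<rho> a, orbit \<rho> b}"
    if \<rho>: "\<rho> permutes {1..n}" for \<rho>
  proof -
    have "orbit \<rho> a \<in> perm_cycles n \<rho>" "orbit \<rho> b \<in> perm_cycles n \<rho>"
      using assms by (auto simp: perm_cycles_def)
    moreover have "C = orbit \<rho> a \<or> C = orbit \<rho> b"
      if "C \<in> perm_cycles n \<rho>" "a \<in> C \<or> b \<in> C" for C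
      using that orbit_eqI_mem[OF \<rho>] by (force simp: perm_cycles_def)
    ultimately show ?thesis by blast
  qed
  have "C \<in> perm_cycles n \<sigma> \<longleftrightarrow> C \<in> perm_cycles n ?\<tau>" if "a \<notin> C" "b \<notin> C" for C
    using perm_cycles_avoiding_transpose[OF _ that assms(1)]
      perm_cycles_avoiding_transpose[OF _ that \<tau>] by (auto simp only: \<sigma>)
  then have R': "R = {C \<in> perm_cycles n ?\<tau>. a \<notin> C \<and> b \<notin> C}"
    by (auto simp: R_def)
  show ?thesis
  proof
    show "finite R" by (simp add: R_def)
    show "\<forall>C\<in>R. a \<notin> C \<and> b \<notin> C" by (simp add: R_def)
    show "perm_cycles n \<sigma> = R \<union> {orbit \<sigma> a, orbit \<sigma> b}"
      unfolding R_def by (rule split[OF assms(1)])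
    show "perm_cycles n ?\<tau> = R \<union> {orbit ?\<tau> a, orbit ?\<tau> b}"
      unfolding R' by (rule split[OF \<tau>])
  qed
qed

text \<open>With R the unaffected cycles, there are at most |R| + 2 cycles after the multiplication
  and at least |R| + 1 before it.\<close>

lemma card_perm_cycles_transpose_le:
  assumes "\<sigma> permutes {1..n}" "a \<in> {1..n}" "b \<in> {1..n}"
  shows "card (perm_cycles n (transpose a b \<circ> \<sigma>)) \<le> Suc (card (perm_cycles n \<sigma>))"
proof -
  obtain R where R: "finite R" "\<forall>C\<in>R. a \<notin> C \<and> b \<notin> C"
    "perm_cycles n \<sigma> = R \<union> {orbit \<sigma> a, orbit \<sigma> b}"
    "perm_cycles n (transpose a b \<circ> \<sigma>) =
      R \<union> {orbit (transpose a b \<circ> \<sigma>) a, orbit (transpose a b \<circ> \<sigma>) b}"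
    by (rule perm_cycles_transpose[OF assms])
  have "card (perm_cycles n (transpose a b \<circ> \<sigma>)) \<le> card R + 2"
    unfolding R(4) by (rule order.trans[OF card_Un_le]) (simp add: card_insert_if)
  moreover have "card R + 1 \<le> card (perm_cycles n \<sigma>)"
  proof -
    have "orbit \<sigma> a \<notin> R" using R(2) mem_orbit_self[OF assms(1)] by blast
    then have "card (insert (orbit \<sigma> a) R) = card R + 1" using R(1) by simp
    moreover have "insert (orbit \<sigma> a) R \<subseteq> perm_cycles n \<sigma>" using R(3) by auto
    ultimately show ?thesis by (metis card_mono finite_perm_cycles)
  qed
  ultimately show ?thesis by simp
qed

text \<open>Starting at a, both permutations agree until \<sigma> returns to a for the first time;
  at that moment the transposition diverts the path to b.\<close>

lemma orbit_transpose_merge: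
  fixes n :: nat
  assumes "\<sigma> permutes {1..n}" "b \<notin> orbit \<sigma> a"
  shows "b \<in> orbit (transpose a b \<circ> \<sigma>) a"
proof -
  let ?\<tau> = "transpose a b \<circ> \<sigma>"
  have self: "a \<in> orbit \<sigma> a" using mem_orbit_self[OF assms(1)] .
  let ?k = "funpow_dist1 \<sigma> a a"
  have step: "j < ?k \<Longrightarrow> (?\<tau> ^^ j) a = (\<sigma> ^^ j) a" for j
  proof (induction j)
    case (Suc j)
    have "(\<sigma> ^^ Suc j) a \<noteq> a"
      using Suc.prems by (intro funpow_dist1_least) auto
    moreover have "(\<sigma> ^^ Suc j) a \<noteq> b"
      using funpow_in_orbit[OF self, of "Suc j"] assms(2) by auto
    ultimately show ?case using Suc by (simp add: transpose_def)
  qed simp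
  have "(?\<tau> ^^ ?k) a = transpose a b ((\<sigma> ^^ ?k) a)"
    using step[of "?k - 1"] by simp
  also have "\<dots> = b" using funpow_dist1_prop[OF self] by simp
  finally have "b = (?\<tau> ^^ ?k) a" by simp
  then show ?thesis unfolding orbit_altdef by (intro CollectI exI[of _ ?k]) simp
qed

lemma card_perm_cycles_transpose_merge:
  assumes "\<sigma> permutes {1..n}" "a \<in> {1..n}" "b \<in> {1..n}" "b \<notin> orbit \<sigma> a"
  shows "Suc (card (perm_cycles n (transpose a b \<circ> \<sigma>))) = card (perm_cycles n \<sigma>)"
proof -
  let ?\<tau> = "transpose a b \<circ> \<sigma>"
  obtain R where R: "finite R" "\<forall>C\<in>R. a \<notin> C \<and> b \<notin> C"
    "perm_cycles n \<sigma> = R \<union> {orbit \<sigma> a, orbit \<sigma> b}"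
    "perm_cycles n ?\<tau> = R \<union> {orbit ?\<tau> a, orbit ?\<tau> b}"
    by (rule perm_cycles_transpose[OF assms(1-3)])
  have \<tau>: "?\<tau> permutes {1..n}"
    using assms by (intro permutes_compose permutes_swap_id)
  have "orbit ?\<tau> b = orbit ?\<tau> a"
    using orbit_eqI_mem[OF \<tau> orbit_transpose_merge[OF assms(1,4)]] .
  moreover have "orbit ?\<tau> a \<notin> R" "orbit \<sigma> a \<notin> R" "orbit \<sigma> b \<notin> R" "orbit \<sigma> b \<noteq> orbit \<sigma> a"
    using R(2)
      mem_orbit_self[OF assms(1), of a] mem_orbit_self[OF assms(1), of b]
      mem_orbit_self[OF \<tau>, of a] assms(4) by auto
  ultimately show ?thesis unfolding R(3,4) using R(1) by simp
qed

text \<open>The cycle listing B in increasing order, extended by the identity. The form with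
  \<open>Min\<close> and \<open>Max\<close> lets its values be found by comparing numbers instead of
  list positions.\<close>

definition cyc_succ :: "nat set \<Rightarrow> nat \<Rightarrow> nat" where
  "cyc_succ B x = (if x \<in> B then if x = Max B then Min B else Min {y \<in> B. x < y} else x)"

text \<open>The cycle maps a list to its rotation by one, so position i goes to position i + 1
  modulo the length, and sortedness turns positions into order.\<close>

lemma cycle_of_sorted_list_of_set:
  assumes "finite B"
  shows "cycle_of_list (sorted_list_of_set B) = cyc_succ B"
proof
  fix x
  let ?cs = "sorted_list_of_set B"
  have set: "set ?cs = B" and srt: "sorted ?cs" and dst: "distinct ?cs" using assms by auto
  show "cycle_of_list ?cs x = cyc_succ B x"
  proof (cases "x \<in> B")
    case False
    then show ?thesis using id_outside_supp[of x ?cs] set by (simp add: cyc_succ_def)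
  next
    case True
    then obtain i where i: "i < length ?cs" "?cs ! i = x" using set by (metis in_set_conv_nth)
    have "map (cycle_of_list ?cs) ?cs = rotate1 ?cs"
      using cyclic_rotation[OF dst, of 1] by simp
    then have eq: "cycle_of_list ?cs x = ?cs ! (Suc i mod length ?cs)"
      using i by (metis nth_map nth_rotate1)
    have mono: "?cs ! j \<le> ?cs ! k \<longleftrightarrow> j \<le> k" if "j < length ?cs" "k < length ?cs" for j k
      using that srt dst by (metis nat_le_linear nth_eq_iff_index_eq order_antisym sorted_nth_mono)
    have bnd: "\<exists>j<length ?cs. y = ?cs ! j" if "y \<in> B" for y
      using that set by (metis in_set_conv_nth)
    have mem: "?cs ! j \<in> B" if "j < length ?cs" for j using that set nth_mem by blast
    show ?thesis
    proof (cases "Suc i = length ?cs")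
      case last: True
      have "Max B = x"
      proof (rule Max_eqI)
        fix y assume "y \<in> B"
        then show "y \<le> x" using bnd[of y] mono[OF _ i(1)] i(2) last by auto
      qed (use assms True in auto)
      moreover have "Min B = ?cs ! 0"
      proof (rule Min_eqI)
        fix y assume "y \<in> B"
        then show "?cs ! 0 \<le> y" using bnd[of y] mono[of 0] i(1) by fastforce
      qed (use assms mem[of 0] i in auto)
      ultimately show ?thesis using eq True last by (simp add: cyc_succ_def)
    next
      case False
      then have j: "Suc i < length ?cs" using i by simp
      then have lt: "x < ?cs ! Suc i" using mono[of "Suc i" i] i by auto
      then have "x \<noteq> Max B" using mem[OF j] assms by (meson Max_ge leD)
      moreover have "Min {y \<in> B. x < y} = ?cs ! Suc i"
      proof (rule Min_eqI)
        fix y assume y: "y \<in> {y \<in> B. x < y}"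
        then obtain k where k: "k < length ?cs" "y = ?cs ! k" using bnd by blast
        then have "i < k" using y mono[of k i] i by fastforce
        then show "?cs ! Suc i \<le> y" using mono[OF j k(1)] k by simp
      qed (use assms mem[OF j] lt in auto)
      ultimately show ?thesis using eq True j by (simp add: cyc_succ_def)
    qed
  qed
qed

subsection \<open>Non-crossing permutations\<close>

lemma cyc_succ_permutes: "finite B \<Longrightarrow> cyc_succ B permutes B"
  using cycle_permutes[of "sorted_list_of_set B"] by (simp add: cycle_of_sorted_list_of_set)

lemma cyc_succ_notin [simp]: "x \<notin> B \<Longrightarrow> cyc_succ B x = x"
  by (simp add: cyc_succ_def)

lemma cyc_succ_mem: "finite B \<Longrightarrow> x \<in> B \<Longrightarrow> cyc_succ B x \<in> B"
  by (simp add: cyc_succ_permutes permutes_in_image)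

lemma cyc_succ_Max: "finite B \<Longrightarrow> B \<noteq> {} \<Longrightarrow> cyc_succ B (Max B) = Min B"
  by (simp add: cyc_succ_def)

lemma cyc_succ_greater: 
  assumes "finite B" "x \<in> B" "x \<noteq> Max B"
  shows "x < cyc_succ B x"
proof -
  have "Max B \<in> B" "x \<le> Max B" using assms by (auto intro: Max_in)
  then have "Max B \<in> {y \<in> B. x < y}"
    using assms(3) by simp
  then have "Min {y \<in> B. x < y} \<in> {y \<in> B. x < y}"
    using assms(1) by (intro Min_in) auto
  then show ?thesis using assms by (simp add: cyc_succ_def)
qed

lemma cyc_succ_le: "finite B \<Longrightarrow> x \<in> B \<Longrightarrow> y \<in> B \<Longrightarrow> x < y \<Longrightarrow> cyc_succ B x \<le> y"
  by (auto simp: cyc_succ_def)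

lemma cyc_succ_greater_iff: "finite B \<Longrightarrow> x \<in> B \<Longrightarrow> x < cyc_succ B x \<longleftrightarrow> x \<noteq> Max B"
  using cyc_succ_greater cyc_succ_Max by (metis Min_le empty_iff leD)

lemma cyc_succ_eqI:
  assumes "finite B" "x \<in> B" "y \<in> B" "x < y" "\<And>z. z \<in> B \<Longrightarrow> x < z \<Longrightarrow> y \<le> z"
  shows "cyc_succ B x = y"
proof -
  have "x \<noteq> Max B" using assms by (metis Max_ge leD)
  then show ?thesis
    using assms cyc_succ_le[of B x y] cyc_succ_greater[of B x] cyc_succ_mem[of B x]
    by (meson antisym)
qed

text \<open>The largest point of the orbit must be \<open>Max B\<close>, since anywhere else the
  successor is larger. Hence \<open>Min B\<close> is reached, and every other point has a smaller
  predecessor, so strong induction reaches it too.\<close>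

lemma orbit_cyc_succ:
  assumes "finite B" "x \<in> B"
  shows "orbit (cyc_succ B) x = B"
proof
  let ?O = "orbit (cyc_succ B) x"
  show sub: "?O \<subseteq> B"
    using assms by (intro orbit_subset_invariant cyc_succ_mem)
  have fin: "finite ?O" "?O \<noteq> {}"
    using finite_subset[OF sub assms(1)] by (simp_all add: orbit_nonempty)
  then have "Max ?O \<in> ?O" by (rule Max_in)
  then have M: "Max ?O \<in> ?O" "cyc_succ B (Max ?O) \<in> ?O"
    by (simp_all add: orbit.step)
  then have "Max ?O = Max B"
    using cyc_succ_greater[OF assms(1), of "Max ?O"] sub fin Max_ge[OF fin(1) M(2)] by fastforce
  then have Min: "Min B \<in> ?O" using M(2) cyc_succ_Max[OF assms(1)] assms(2) by force
  show "B \<subseteq> ?O"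
  proof
    fix y assume "y \<in> B"
    then show "y \<in> ?O"
    proof (induction y rule: less_induct)
      case (less y)
      show ?case
      proof (cases "y = Min B")
        case False
        obtain w where w: "w \<in> B" "cyc_succ B w = y"
          using less.prems permutes_image[OF cyc_succ_permutes[OF assms(1)]] by (metis imageE)
        have "w \<noteq> Max B" using False w assms by (metis cyc_succ_Max empty_iff)
        then have "w < y" using cyc_succ_greater assms w by metis
        then show ?thesis using less.IH w by (metis orbit.step)
      qed (use Min in simp)
    qed
  qed
qed

section \<open>The permutation of a partition and its blocks\<close>

lemma partition_on_unique:
  "partition_on A P \<Longrightarrow> B \<in> P \<Longrightarrow> C \<in> P \<Longrightarrow> x \<in> B \<Longrightarrow> x \<in> C \<Longrightarrow> B = C"
  by (meson disjnt_iff pairwiseD partition_onD2)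

lemma partition_on_finite_block: "partition_on A P \<Longrightarrow> finite A \<Longrightarrow> B \<in> P \<Longrightarrow> finite B"
  by (metis Union_upper finite_subset partition_onD1)

lemma perm_of_partition_block:
  assumes "partition_on A P" "finite A" "B \<in> P" "x \<in> B"
  shows "perm_of_partition P x = cyc_succ B x"
proof -
  have "(THE B. B \<in> P \<and> x \<in> B) = B"
    using assms partition_on_unique[OF assms(1)] by (intro the_equality) blast+
  moreover have "finite B" using assms partition_on_finite_block by blast
  ultimately show ?thesis
    using assms(3,4) by (auto simp: perm_of_partition_def cycle_of_sorted_list_of_set)
qed

lemma perm_of_partition_outside: "partition_on A P \<Longrightarrow> x \<notin> A \<Longrightarrow> perm_of_partition P x = x"
  unfolding perm_of_partition_def by (simp only: flip: partition_onD1) simp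

lemma perm_of_partition_permutes:
  assumes "partition_on A P" "finite A"
  shows "perm_of_partition P permutes A"
proof (rule bij_imp_permutes)
  let ?\<sigma> = "perm_of_partition P"
  have blk: "\<exists>B\<in>P. x \<in> B" if "x \<in> A" for x using that assms by (auto simp: partition_on_def)
  have fin: "finite B" if "B \<in> P" for B using partition_on_finite_block[OF assms that] .
  have mem: "?\<sigma> x \<in> B" if "B \<in> P" "x \<in> B" for B x
    using that perm_of_partition_block[OF assms that] cyc_succ_mem[OF fin] by simp
  have "inj_on ?\<sigma> A"
  proof (rule inj_onI)
    fix x y assume xy: "x \<in> A" "y \<in> A" "?\<sigma> x = ?\<sigma> y"
    obtain B C where B: "B \<in> P" "x \<in> B" and C: "C \<in> P" "y \<in> C" using blk xy by blast
    then have "B = C" using mem[OF B] mem[OF C] xy(3) partition_on_unique[OF assms(1)] by metis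
    then show "x = y"
      using xy(3) perm_of_partition_block[OF assms] B C
        permutes_inj[OF cyc_succ_permutes[OF fin]] by (metis injD)
  qed
  moreover have "?\<sigma> ` A \<subseteq> A" using mem blk partition_onD1[OF assms(1)] by blast
  ultimately show "bij_betw ?\<sigma> A A"
    using assms(2) by (simp add: bij_betw_def endo_inj_surj)
qed (use assms perm_of_partition_outside in blast)

lemma orbit_perm_of_partition:
  assumes "partition_on A P" "finite A" "B \<in> P" "x \<in> B"
  shows "orbit (perm_of_partition P) x = B"
proof -
  have "finite B" using assms partition_on_finite_block by blast
  then have "orbit (cyc_succ B) x = orbit (perm_of_partition P) x"
    using perm_of_partition_block[OF assms(1-3)] assms(4) cyc_succ_mem
    by (intro orbit_cong0[of x B]) auto
  then show ?thesis using orbit_cyc_succ[OF \<open>finite B\<close> assms(4)] by simp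
qed

lemma perm_cycles_perm_of_partition:
  assumes "partition_on {1..n} P"
  shows "perm_cycles n (perm_of_partition P) = P"
proof -
  have P: "\<Union>P = {1..n}" "{} \<notin> P" using assms by (auto simp: partition_on_def)
  have eq: "orbit (perm_of_partition P) x = B" if "B \<in> P" "x \<in> B" for B x
    using orbit_perm_of_partition[OF assms _ that] by simp
  show ?thesis unfolding perm_cycles_def
  proof (intro set_eqI iffI)
    fix B assume "B \<in> orbit (perm_of_partition P) ` {1..n}"
    then obtain x where x: "x \<in> \<Union>P" "B = orbit (perm_of_partition P) x" unfolding P(1) by blast
    then obtain C where "x \<in> C" "C \<in> P" by blast
    with x show "B \<in> P" using eq by simp
  next
    fix B assume B: "B \<in> P"
    then obtain x where x: "x \<in> B" using P(2) by fastforce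
    then have "x \<in> {1..n}" using B P(1) by blast
    then show "B \<in> orbit (perm_of_partition P) ` {1..n}" using eq[OF B x] by blast
  qed
qed

lemma noncrossing_same:
  assumes "noncrossing P" "B \<in> P" "C \<in> P"
    "a \<in> B" "b \<in> B" "c \<in> C" "d \<in> C" "a < c" "c < b" "b < d"
  shows "B = C"
proof (rule ccontr)
  assume ne: "B \<noteq> C"
  have "\<exists>B\<in>P. \<exists>C\<in>P. B \<noteq> C \<and>
      (\<exists>a\<in>B. \<exists>b\<in>B. \<exists>c\<in>C. \<exists>d\<in>C. a < c \<and> c < b \<and> b < d)"
    by (rule bexI[OF _ assms(2)], rule bexI[OF _ assms(3)], rule conjI[OF ne],
        rule bexI[OF _ assms(4)], rule bexI[OF _ assms(5)],
        rule bexI[OF _ assms(6)], rule bexI[OF _ assms(7)], simp add: assms(8-))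
  then show False using assms(1) unfolding noncrossing_def by (elim notE)
qed

lemma NC_obtain:
  assumes "\<sigma> \<in> NC n"
  obtains P where "partition_on {1..n} P" "noncrossing P" "perm_cycles n \<sigma> = P"
    "\<sigma> = perm_of_partition P"
  using assms by (auto simp: NC_def noncrossing_partitions_def perm_cycles_perm_of_partition)

lemma NC_permutes: "\<sigma> \<in> NC n \<Longrightarrow> \<sigma> permutes {1..n}"
  by (metis NC_obtain finite_atLeastAtMost perm_of_partition_permutes)

lemma NC_blockE:
  assumes "\<sigma> \<in> NC n" "x \<in> {1..n}"
  obtains B where "B \<in> perm_cycles n \<sigma>" "x \<in> B" "finite B" "\<forall>y\<in>B. \<sigma> y = cyc_succ B y"
proof -
  obtain P where P: "partition_on {1..n} P" "perm_cycles n \<sigma> = P" "\<sigma> = perm_of_partition P"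
    using NC_obtain[OF assms(1)] by metis
  then obtain B where "B \<in> P" "x \<in> B" using assms(2) partition_onD1 by blast
  then show thesis
    using that[of B] P perm_of_partition_block[OF P(1)] partition_on_finite_block[OF P(1)] by simp
qed

lemma NC_noncrossing: "\<sigma> \<in> NC n \<Longrightarrow> noncrossing (perm_cycles n \<sigma>)"
  by (metis NC_obtain)

text \<open>A weak descent occurs only at the greatest element x of a block, with \<sigma> x the
  least. A step of another block leaving this span would cross the block through \<sigma> x and
  x.\<close>

lemma NC_descent_invariant:
  assumes "\<sigma> \<in> NC n" "x \<in> {1..n}" "\<sigma> x \<le> x" "z \<in> {\<sigma> x..x}"
  shows "\<sigma> z \<in> {\<sigma> x..x}"
proof -
  note part = partition_on_perm_cycles[OF NC_permutes[OF assms(1)]]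
  obtain B where B: "B \<in> perm_cycles n \<sigma>" "x \<in> B" "finite B" "\<forall>y\<in>B. \<sigma> y = cyc_succ B y"
    by (rule NC_blockE[OF assms(1,2)])
  have "x = Max B"
    using cyc_succ_greater[OF B(3,2)] bspec[OF B(4,2)] assms(3) leD by auto
  moreover have "B \<noteq> {}" using B(2) by blast
  ultimately have x: "x = Max B" "\<sigma> x = Min B"
    using cyc_succ_Max[OF B(3)] bspec[OF B(4,2)] by simp_all
  have "z \<in> {1..n}" using assms(2,4) NC_permutes[OF assms(1)]
    by (metis atLeastAtMost_iff le_trans permutes_in_image)
  then obtain C where C: "C \<in> perm_cycles n \<sigma>" "z \<in> C" "finite C" "\<forall>y\<in>C. \<sigma> y = cyc_succ C y"
    by (rule NC_blockE[OF assms(1)])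
  have w: "\<sigma> z \<in> C" using C cyc_succ_mem by metis
  have bounds: "y \<in> {\<sigma> x..x}" if "y \<in> B" for y using that x B(3) by simp
  have \<sigma>x: "\<sigma> x \<in> B" using B cyc_succ_mem by metis
  show ?thesis
  proof (cases "B = C")
    case True then show ?thesis using bounds w by simp
  next
    case False
    have disj: "y \<notin> C" if "y \<in> B" for y
      using partition_on_unique[OF part B(1) C(1) that] False by blast
    have "z \<noteq> x" "z \<noteq> \<sigma> x" "\<sigma> z \<noteq> x" "\<sigma> z \<noteq> \<sigma> x"
      using disj[OF B(2)] disj[OF \<sigma>x] C(2) w by metis+
    moreover from this have lt: "\<sigma> x < z" "z < x" using assms(4) by auto
    moreover have "\<not> x < \<sigma> z"
      using noncrossing_same[OF NC_noncrossing[OF assms(1)] B(1) C(1) \<sigma>x B(2) C(2) w lt] False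
      by blast
    moreover have "\<not> \<sigma> z < \<sigma> x"
      using noncrossing_same[OF NC_noncrossing[OF assms(1)] C(1) B(1) w C(2) \<sigma>x B(2) _ lt] False
      by blast
    ultimately show ?thesis by simp
  qed
qed

text \<open>Here x and \<sigma> x are consecutive elements of their block, so z lies in a different
  block, and a step out of the gap would cross.\<close>

lemma NC_ascent_invariant:
  assumes "\<sigma> \<in> NC n" "x \<in> {1..n}" "x < \<sigma> x" "z \<in> {x<..<\<sigma> x}"
  shows "\<sigma> z \<in> {x<..<\<sigma> x}"
proof -
  note part = partition_on_perm_cycles[OF NC_permutes[OF assms(1)]]
  obtain B where B: "B \<in> perm_cycles n \<sigma>" "x \<in> B" "finite B" "\<forall>y\<in>B. \<sigma> y = cyc_succ B y"
    by (rule NC_blockE[OF assms(1,2)])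
  have \<sigma>x: "\<sigma> x \<in> B" using B cyc_succ_mem by metis
  have "\<sigma> x \<in> {1..n}" using assms(2) NC_permutes[OF assms(1)] by (simp only: permutes_in_image)
  then have "z \<in> {1..n}" using assms(2,4) by simp
  then obtain C where C: "C \<in> perm_cycles n \<sigma>" "z \<in> C" "finite C" "\<forall>y\<in>C. \<sigma> y = cyc_succ C y"
    by (rule NC_blockE[OF assms(1)])
  have w: "\<sigma> z \<in> C" using C cyc_succ_mem by metis
  have "B \<noteq> C"
    using cyc_succ_le[OF B(3,2), of z] bspec[OF B(4,2)] C(2) assms(4) by auto
  then have disj: "y \<notin> C" if "y \<in> B" for y
    using partition_on_unique[OF part B(1) C(1) that] by blast
  have "z \<noteq> x" "z \<noteq> \<sigma> x" "\<sigma> z \<noteq> x" "\<sigma> z \<noteq> \<sigma> x"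
    using disj[OF B(2)] disj[OF \<sigma>x] C(2) w by metis+
  moreover have lt: "x < z" "z < \<sigma> x" using assms(4) by auto
  moreover have "\<not> \<sigma> x < \<sigma> z"
    using noncrossing_same[OF NC_noncrossing[OF assms(1)] B(1) C(1) B(2) \<sigma>x C(2) w lt] \<open>B \<noteq> C\<close>
    by blast
  moreover have "\<not> \<sigma> z < x"
    using noncrossing_same[OF NC_noncrossing[OF assms(1)] C(1) B(1) w C(2) B(2) \<sigma>x _ lt] \<open>B \<noteq> C\<close>
    by blast
  ultimately show ?thesis by simp
qed

text \<open>Converse of \<open>NC_descent_invariant\<close>. A cycle meeting an invariant interval
  lies inside it, so weak descents occur only at the maximum of a cycle and lead to its minimum;
  this determines \<sigma> as the increasing cycle on each of its orbits.\<close>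

lemma NC_I:
  assumes perm: "\<sigma> permutes {1..n}"
    and desc: "\<And>x z. x \<in> {1..n} \<Longrightarrow> \<sigma> x \<le> x \<Longrightarrow> z \<in> {\<sigma> x..x} \<Longrightarrow> \<sigma> z \<in> {\<sigma> x..x}"
  shows "\<sigma> \<in> NC n"
proof -
  let ?P = "perm_cycles n \<sigma>"
  note part = partition_on_perm_cycles[OF perm]
  have orb: "orbit \<sigma> x = C" if "C \<in> ?P" "x \<in> C" for C x
    using that orbit_eqI_mem[OF perm] by (auto simp: perm_cycles_def)
  have fin: "finite C" if "C \<in> ?P" for C using partition_on_finite_block[OF part _ that] by simp
  have sub: "C \<subseteq> {1..n}" if "C \<in> ?P" for C using that part by (auto simp: partition_on_def)
  have ne: "C \<noteq> {}" if "C \<in> ?P" for C using that part by (auto simp: partition_on_def)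
  have mem: "\<sigma> x \<in> C" if "C \<in> ?P" "x \<in> C" for C x
    using orb[OF that] by (metis orbit.base)
  have invar: "C \<subseteq> {\<sigma> x..x}" if "x \<in> {1..n}" "\<sigma> x \<le> x" "C \<in> ?P" "z \<in> C" "z \<in> {\<sigma> x..x}" for C x z
    using orbit_subset_invariant[of z "{\<sigma> x..x}" \<sigma>] orb[OF that(3,4)] desc[OF that(1,2)] that(5)
    by blast
  have up: "x < \<sigma> x" if C: "C \<in> ?P" "x \<in> C" "x \<noteq> Max C" for C x
  proof (rule ccontr)
    assume "\<not> x < \<sigma> x"
    moreover have "x \<in> {1..n}" using C(2) sub[OF C(1)] by blast
    ultimately have "C \<subseteq> {\<sigma> x..x}" using invar[of x C x] C by simp
    then have "Max C \<le> x" using Max_in[OF fin[OF C(1)] ne[OF C(1)]] by auto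
    then show False using C Max_ge[OF fin[OF C(1)] C(2)] by simp
  qed
  have top: "\<sigma> (Max C) = Min C" and span: "\<And>D z. D \<in> ?P \<Longrightarrow> z \<in> D \<Longrightarrow> z \<in> {Min C..Max C} \<Longrightarrow> D \<subseteq> {Min C..Max C}"
    if C: "C \<in> ?P" for C
  proof -
    have M: "Max C \<in> C" "Max C \<in> {1..n}" using Max_in[OF fin ne] C sub by blast+
    have le: "\<sigma> (Max C) \<le> Max C" using mem[OF C M(1)] fin[OF C] by simp
    then have "C \<subseteq> {\<sigma> (Max C)..Max C}" using invar[OF M(2) le C M(1)] by simp
    then show eq: "\<sigma> (Max C) = Min C"
      using mem[OF C M(1)] fin[OF C] by (intro Min_eqI[symmetric]) auto
    show "D \<subseteq> {Min C..Max C}" if "D \<in> ?P" "z \<in> D" "z \<in> {Min C..Max C}" for D z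
      using invar[OF M(2) le that(1,2)] that(3) unfolding eq .
  qed
  \<comment> \<open>Induction downwards from \<open>Max C\<close>. The point w of C with
    \<open>cyc_succ C w\<close> equal to \<sigma> x is not below x, as its successor would then be
    at most x < \<sigma> x, and not above x, as the induction hypothesis would give \<sigma> w =
    \<sigma> x.\<close>
  have succ: "\<sigma> x = cyc_succ C x" if C: "C \<in> ?P" and x: "x \<in> C" for C x
    using x
  proof (induction "Max C - x" arbitrary: x rule: less_induct)
    case less
    show ?case
    proof (cases "x = Max C")
      case True
      then show ?thesis using top[OF C] cyc_succ_Max[OF fin[OF C] ne[OF C]] by simp
    next
      case False
      obtain w where w: "w \<in> C" "cyc_succ C w = \<sigma> x"
        using mem[OF C less.prems] permutes_image[OF cyc_succ_permutes[OF fin[OF C]]] by (metis imageE)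
      have lt: "x < \<sigma> x" using up[OF C less.prems False] .
      have "\<not> w < x" using cyc_succ_le[OF fin[OF C] w(1) less.prems] w(2) lt by auto
      moreover have "\<not> x < w"
      proof
        assume xw: "x < w"
        have "w \<le> Max C" using w fin[OF C] by simp
        then have "\<sigma> w = cyc_succ C w" using xw less.hyps[of w] w(1) by simp
        then show False using w(2) xw permutes_inj[OF perm] by (auto dest: injD)
      qed
      ultimately show ?thesis using w by simp
    qed
  qed
  have "\<sigma> = perm_of_partition ?P"
  proof
    fix x show "\<sigma> x = perm_of_partition ?P x"
    proof (cases "x \<in> {1..n}")
      case True
      then obtain C where "C \<in> ?P" "x \<in> C" using part partition_onD1 by blast
      then show ?thesis using succ perm_of_partition_block[OF part] by simp
    next
      case False
      then show ?thesis
        using perm_of_partition_outside[OF part] permutes_not_in[OF perm] by simp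
    qed
  qed
  moreover have "noncrossing ?P"
    unfolding noncrossing_def
  proof (intro notI, elim bexE conjE)
    fix B C a b c d
    assume h: "B \<in> ?P" "C \<in> ?P" "a \<in> B" "b \<in> B" "c \<in> C" "d \<in> C" "a < c" "c < b" "b < d"
      and ne': "B \<noteq> C"
    \<comment> \<open>A crossing puts a point of each cycle into the span of the other, so each span
      contains the other cycle; the minima then agree, and the two cycles share a point.\<close>
    have bnd: "Min B \<le> a" "b \<le> Max B" "Min C \<le> c" "d \<le> Max C"
      using h fin[OF h(1)] fin[OF h(2)] by auto
    then have "C \<subseteq> {Min B..Max B}" "B \<subseteq> {Min C..Max C}"
      using span[OF h(1,2,5)] span[OF h(2,1,4)] h(7-9) by auto
    then have "Min B = Min C"
      using Min_in[OF fin ne, OF h(1) h(1)] Min_in[OF fin ne, OF h(2) h(2)]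
      by (meson antisym atLeastAtMost_iff subsetD)
    then show False
      using partition_on_unique[OF part h(1,2)] ne'
        Min_in[OF fin ne, OF h(1) h(1)] Min_in[OF fin ne, OF h(2) h(2)] by metis
  qed
  ultimately show ?thesis
    unfolding NC_def noncrossing_partitions_def using part by blast
qed

subsection \<open>Kreweras complements and cycle counts\<close>

lemma finite_NC [simp]: "finite (NC n)"
proof -
  have "noncrossing_partitions n \<subseteq> {P. partition_on {1..n} P}"
    by (auto simp: noncrossing_partitions_def)
  then have "finite (noncrossing_partitions n)"
    using finitely_many_partition_on[of "{1..n}"] by (auto intro: finite_subset)
  then show ?thesis by (simp add: NC_def)
qed

lemma full_cycle_eq: "full_cycle n = cyc_succ {1..n}"
  using cycle_of_sorted_list_of_set[of "{1..n}"] 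
  by (simp only: full_cycle_def flip: atLeastLessThanSuc_atLeastAtMost) simp

lemma full_cycle_permutes: "full_cycle n permutes {1..n}"
  by (simp only: full_cycle_eq cyc_succ_permutes finite_atLeastAtMost)

lemma full_cycle_less: "1 \<le> x \<Longrightarrow> x < n \<Longrightarrow> full_cycle n x = Suc x"
  unfolding full_cycle_eq by (rule cyc_succ_eqI) auto

lemma full_cycle_last: "1 \<le> n \<Longrightarrow> full_cycle n n = 1"
  using cyc_succ_Max[of "{1..n}"] Max_eqI[of "{1..n}" n] Min_eqI[of "{1..n}" 1]
  by (simp add: full_cycle_eq)

lemma kreweras_permutes: "\<beta> permutes {1..n} \<Longrightarrow> kreweras n \<beta> permutes {1..n}"
  unfolding kreweras_def by (intro permutes_compose full_cycle_permutes permutes_inv)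

text \<open>An injective map of a finite set into itself is onto, so invariance under f passes to
  the inverse of f.\<close>

lemma inv_mem_invariant:
  assumes "bij f" "finite I" "\<And>z. z \<in> I \<Longrightarrow> f z \<in> I" "w \<in> I"
  shows "inv f w \<in> I"
proof -
  have "f ` I = I"
    using assms(1-3) by (intro endo_inj_surj) (auto simp: bij_def inj_on_def)
  then obtain z where "z \<in> I" "w = f z" using assms(4) by blast
  then show ?thesis using assms(1) by (simp add: bij_def)
qed

text \<open>Let y be the image of x under the complement, so that \<beta> y is the image of x under
  the full cycle. If x < n then \<beta> y = x + 1 is an ascent, and the gap between y and x + 1 is
  invariant and contains z + 1 for y \<le> z < x. If x = n then \<beta> y = 1, so {1..y} is
  invariant and the preimage of z + 1 > y must exceed y.\<close>

lemma NC_kreweras: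
  assumes "\<beta> \<in> NC n"
  shows "kreweras n \<beta> \<in> NC n"
proof (rule NC_I)
  note perm = NC_permutes[OF assms]
  have bij: "bij \<beta>" using perm by (rule permutes_bij)
  have inv: "\<beta> (inv \<beta> y) = y" for y using permutes_inverses(1)[OF perm] .
  show "kreweras n \<beta> permutes {1..n}" by (rule kreweras_permutes[OF perm])
  fix x z
  let ?y = "kreweras n \<beta> x"
  assume x: "x \<in> {1..n}" and le: "?y \<le> x" and z: "z \<in> {?y..x}"
  have y: "?y \<in> {1..n}" using x by (simp only: permutes_in_image[OF kreweras_permutes[OF perm]])
  have \<beta>y: "\<beta> ?y = full_cycle n x" by (simp add: kreweras_def inv)
  show "kreweras n \<beta> z \<in> {?y..x}"
  proof (cases "z = x")
    case False
    then have zx: "z < x" "1 \<le> z" "z < n" using z y x by auto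
    then have \<kappa>z: "kreweras n \<beta> z = inv \<beta> (Suc z)"
      by (simp add: kreweras_def full_cycle_less)
    show ?thesis
    proof (cases "x < n")
      case True
      then have eq: "\<beta> ?y = Suc x" using \<beta>y full_cycle_less x by simp
      have "inv \<beta> (Suc z) \<in> {?y<..<\<beta> ?y}"
        using NC_ascent_invariant[OF assms y] eq le z zx
        by (intro inv_mem_invariant[OF bij]) auto
      then show ?thesis using eq \<kappa>z by auto
    next
      case False
      then have "x = n" using x by simp
      then have eq: "\<beta> ?y = 1" using \<beta>y full_cycle_last x by simp
      have "inv \<beta> (Suc z) \<in> {1..n}"
        using zx permutes_in_image[OF permutes_inv[OF perm], of "Suc z"] by simp
      moreover have "\<not> inv \<beta> (Suc z) \<le> ?y"
      proof
        assume "inv \<beta> (Suc z) \<le> ?y"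
        then have "\<beta> (inv \<beta> (Suc z)) \<in> {\<beta> ?y..?y}"
          using NC_descent_invariant[OF assms y, of "inv \<beta> (Suc z)"] eq y calculation by simp
        then show False using inv z by simp
      qed
      ultimately show ?thesis using \<kappa>z \<open>x = n\<close> by simp
    qed
  qed (use le in simp)
qed

lemma inj_on_kreweras: "inj_on (kreweras n) {\<sigma>. \<sigma> permutes {1..n}}"
proof (rule inj_onI)
  fix \<alpha> \<beta> assume h: "\<alpha> \<in> {\<sigma>. \<sigma> permutes {1..n}}" "\<beta> \<in> {\<sigma>. \<sigma> permutes {1..n}}" "kreweras n \<alpha> = kreweras n \<beta>"
  have "inv \<alpha> y = inv \<beta> y" for y
  proof -
    obtain x where "y = full_cycle n x" using permutes_surj[OF full_cycle_permutes] by (metis surj_def)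
    then show ?thesis using fun_cong[OF h(3), of x] by (simp add: kreweras_def)
  qed
  then have "inv (inv \<alpha>) = inv (inv \<beta>)" by presburger
  then show "\<alpha> = \<beta>" using h(1,2) by (simp add: inv_inv_eq permutes_bij)
qed

lemma bij_betw_kreweras_NC: "bij_betw (kreweras n) (NC n) (NC n)"
proof -
  have inj: "inj_on (kreweras n) (NC n)"
    using inj_on_kreweras by (rule inj_on_subset) (auto dest: NC_permutes)
  then have "kreweras n ` NC n = NC n"
    by (intro endo_inj_surj finite_NC) (auto intro: NC_kreweras)
  then show ?thesis using inj by (simp add: bij_betw_def)
qed

text \<open>Each block has exactly one weak descent, at its maximum.\<close>

lemma card_NC_ascents:
  assumes "\<sigma> \<in> NC n"
  shows "card {x \<in> {1..n}. x < \<sigma> x} + card (perm_cycles n \<sigma>) = n"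
    and "card {x \<in> {1..n}. \<sigma> x \<le> x} = card (perm_cycles n \<sigma>)"
proof -
  let ?P = "perm_cycles n \<sigma>"
  obtain P where P: "partition_on {1..n} P" "?P = P" "\<sigma> = perm_of_partition P"
    using NC_obtain[OF assms] by metis
  have fin: "finite C" if "C \<in> ?P" for C
    using partition_on_finite_block[OF P(1) _ that[unfolded P(2)]] by simp
  have ne: "C \<noteq> {}" if "C \<in> ?P" for C using that P by (auto simp: partition_on_def)
  have Max: "Max C \<in> C" if "C \<in> ?P" for C using Max_in[OF fin ne] that by simp
  have sub: "C \<subseteq> {1..n}" if "C \<in> ?P" for C using that P by (auto simp: partition_on_def)
  have iff: "x < \<sigma> x \<longleftrightarrow> x \<noteq> Max C" if "C \<in> ?P" "x \<in> C" for C x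
    using cyc_succ_greater_iff[OF fin[OF that(1)] that(2)] perm_of_partition_block[OF P(1)] P that by simp
  have "{x \<in> {1..n}. \<not> x < \<sigma> x} = Max ` ?P"
  proof (intro set_eqI iffI)
    fix x assume x: "x \<in> {x \<in> {1..n}. \<not> x < \<sigma> x}"
    then obtain C where "C \<in> ?P" "x \<in> C" using P partition_onD1 by blast
    then show "x \<in> Max ` ?P" using iff x by blast
  next
    fix x assume "x \<in> Max ` ?P"
    then obtain C where "C \<in> ?P" "x = Max C" by blast
    then show "x \<in> {x \<in> {1..n}. \<not> x < \<sigma> x}" using iff Max sub by blast
  qed
  moreover have "inj_on Max ?P"
    using Max partition_on_unique[OF P(1)] unfolding P(2) by (metis inj_onI)
  ultimately have card: "card {x \<in> {1..n}. \<not> x < \<sigma> x} = card ?P"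
    by (simp add: card_image)
  then show "card {x \<in> {1..n}. \<sigma> x \<le> x} = card ?P" by (simp add: not_less)
  have "card {x \<in> {1..n}. x < \<sigma> x} + card {x \<in> {1..n}. \<not> x < \<sigma> x} = card {1..n}"
    by (subst card_Un_disjoint[symmetric]) (auto intro!: arg_cong[where f = card] simp del: card_atLeastAtMost)
  then show "card {x \<in> {1..n}. x < \<sigma> x} + card ?P = n" using card by simp
qed

text \<open>Strict ascents x of the complement satisfy x < \<open>inv \<beta> (Suc x)\<close>, so y
  = x + 1 satisfies y \<le> \<open>inv \<beta> y\<close>. This shift reaches every such y except y =
  1, which always qualifies. The map \<beta> identifies these y with the weak descents of \<beta>,
  one for each block.\<close>

lemma card_perm_cycles_kreweras:
  assumes "\<beta> \<in> NC n" "1 \<le> n"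
  shows "card (perm_cycles n (kreweras n \<beta>)) + card (perm_cycles n \<beta>) = n + 1"
proof -
  note perm = NC_permutes[OF assms(1)]
  let ?A = "{x \<in> {1..n}. x < kreweras n \<beta> x}" and ?B = "{y \<in> {1..n}. y \<le> inv \<beta> y}"
  have "?B = insert 1 (Suc ` ?A)"
  proof (intro set_eqI iffI)
    fix y assume y: "y \<in> ?B"
    then show "y \<in> insert 1 (Suc ` ?A)"
    proof (cases "y = 1")
      case False
      then have "y = Suc (y - 1)" "y - 1 \<in> ?A"
        using y full_cycle_less[of "y - 1" n] by (auto simp: kreweras_def)
      then show ?thesis by blast
    qed simp
  next
    fix y assume "y \<in> insert 1 (Suc ` ?A)"
    moreover have "1 \<in> ?B"
      using assms(2) permutes_in_image[OF permutes_inv[OF perm], of 1] by simp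
    moreover have "Suc x \<in> ?B" if x: "x \<in> ?A" for x
    proof -
      have "kreweras n \<beta> x \<in> {1..n}"
        using x permutes_in_image[OF kreweras_permutes[OF perm], of x] by simp
      then show ?thesis using x full_cycle_less[of x n] by (simp add: kreweras_def)
    qed
    ultimately show "y \<in> ?B" by blast
  qed
  moreover have "1 \<notin> Suc ` ?A" by auto
  ultimately have "card ?B = Suc (card ?A)"
    by (simp add: card_image)
  moreover have "?B = \<beta> ` {z \<in> {1..n}. \<beta> z \<le> z}"
  proof (intro set_eqI iffI)
    fix y assume "y \<in> ?B"
    then show "y \<in> \<beta> ` {z \<in> {1..n}. \<beta> z \<le> z}"
      using permutes_inverses(1)[OF perm, of y] permutes_in_image[OF permutes_inv[OF perm], of y]
      by (intro image_eqI[of _ _ "inv \<beta> y"]) auto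
  next
    fix y assume "y \<in> \<beta> ` {z \<in> {1..n}. \<beta> z \<le> z}"
    then show "y \<in> ?B"
      using permutes_inverses(2)[OF perm] permutes_in_image[OF perm] by auto
  qed
  then have "card ?B = card (perm_cycles n \<beta>)"
    using card_NC_ascents(2)[OF assms(1)] permutes_inj[OF perm] by (simp add: card_image inj_on_subset)
  ultimately show ?thesis
    using card_NC_ascents(1)[OF NC_kreweras[OF assms(1)]] by simp
qed

text \<open>The next element q of S above e exists because n is in S and e < n. The transposition
  redirects the arrow that ended in q to e and sends e, fixed by the old cycle, to q. If e lies
  below S, the redirected arrow is the one from n to \<open>Min S\<close>.\<close>

lemma cyc_succ_insert:
  assumes "S \<subseteq> {1..n}" "n \<in> S" "e \<notin> S" "e < n"
  shows "cyc_succ (insert e S) = transpose e (Min {y \<in> S. e < y}) \<circ> cyc_succ S"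
proof
  fix x
  let ?q = "Min {y \<in> S. e < y}"
  have fin: "finite S" using assms(1) finite_subset by blast
  have "?q \<in> {y \<in> S. e < y}" using fin assms by (intro Min_in) auto
  then have q: "?q \<in> S" "e < ?q" by auto
  have q_le: "?q \<le> y" if "y \<in> S" "e < y" for y using fin that by simp
  have Max: "Max S = n" "Max (insert e S) = n" using assms fin by (auto intro!: Max_eqI)
  have Min_mem: "Min S \<in> S" using fin assms(2) by (intro Min_in) auto
  consider "x = e" | "x \<notin> S" "x \<noteq> e" | "x = n" | "x \<in> S" "x < n"
    using assms(1) by fastforce
  then show "cyc_succ (insert e S) x = (transpose e ?q \<circ> cyc_succ S) x"
  proof cases
    case 1
    have "cyc_succ (insert e S) e = ?q"
      using q q_le fin by (intro cyc_succ_eqI) auto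
    then show ?thesis using 1 assms(3) by simp
  next
    case 2
    then show ?thesis using q by (auto simp: transpose_def)
  next
    case 3
    have "cyc_succ (insert e S) n = min e (Min S)"
      using cyc_succ_Max[of "insert e S"] Max fin Min_insert[OF fin, of e] assms(2)
      by (metis empty_iff finite_insert insert_not_empty)
    moreover have "cyc_succ S n = Min S"
      using cyc_succ_Max[OF fin] Max assms(2) by auto
    moreover have "min e (Min S) = transpose e ?q (Min S)"
    proof (cases "Min S < e")
      case True
      then show ?thesis using q by (auto simp: transpose_def)
    next
      case False
      then have "e < Min S" using Min_mem assms(3) by (metis linorder_neqE_nat)
      then have "Min S = ?q" using q q_le[OF Min_mem] fin by (simp add: antisym)
      then show ?thesis using \<open>e < Min S\<close> by (simp add: transpose_def)
    qed
    ultimately show ?thesis using 3 by simp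
  next
    case 4
    define s where "s = cyc_succ S x"
    have s: "s \<in> S" "x < s" "\<And>y. y \<in> S \<Longrightarrow> x < y \<Longrightarrow> s \<le> y"
      using cyc_succ_mem[OF fin] cyc_succ_greater[OF fin] cyc_succ_le[OF fin] 4 Max
      unfolding s_def by auto
    have "s \<noteq> e" "x \<noteq> e" using s 4 assms(3) by auto
    have "cyc_succ (insert e S) x = transpose e ?q s"
    proof (cases "x < e \<and> e < s")
      case True
      then have "?q = s" using q q_le[OF s(1)] s(3)[of ?q] by simp
      moreover have "cyc_succ (insert e S) x = e"
        using True s(3) fin 4 by (intro cyc_succ_eqI) fastforce+
      ultimately show ?thesis by (simp add: transpose_def)
    next
      case False
      have "s \<noteq> ?q"
      proof
        assume "s = ?q"
        then have "\<not> x < e" using False q(2) by metis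
        moreover have "\<not> e < x" using q_le[OF 4(1)] s(2) \<open>s = ?q\<close> by (metis leD)
        ultimately show False using \<open>x \<noteq> e\<close> by linarith
      qed
      moreover have "cyc_succ (insert e S) x = s"
        using False s fin 4 \<open>s \<noteq> e\<close> by (intro cyc_succ_eqI) (auto simp: not_less)
      ultimately show ?thesis using \<open>s \<noteq> e\<close> by (simp add: transpose_def)
    qed
    then show ?thesis by (simp add: s_def)
  qed
qed

section \<open>How the cycle count depends on S\<close>

definition blocks_avoiding :: "nat \<Rightarrow> (nat \<Rightarrow> nat) \<Rightarrow> nat set \<Rightarrow> nat set set" where
  "blocks_avoiding n \<beta> S = {C \<in> perm_cycles n \<beta>. C \<inter> S = {}}"

text \<open>The part of the count that turns out to be independent of S. It is an integer because
  its value 1 - #\<beta> is never positive.\<close>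

definition cycle_excess :: "nat \<Rightarrow> (nat \<Rightarrow> nat) \<Rightarrow> nat set \<Rightarrow> int" where
  "cycle_excess n \<beta> S =
    int (card (perm_cycles n (inv (cyc_succ S) \<circ> \<beta>))) - int (card S) - 2 * int (card (blocks_avoiding n \<beta> S))"

lemma cyc_succ_permutes_superset:
  assumes "S \<subseteq> {1..n}"
  shows "cyc_succ S permutes {1..n}"
  using permutes_subset[OF cyc_succ_permutes assms] finite_subset[OF assms] by simp

text \<open>If the block of e avoids S, it is still a cycle of the old product, since
  \<open>inv (cyc_succ S)\<close> fixes its points. The transposition then merges two cycles, |S|
  grows by one and d drops by one: the total change is -1 - 1 + 2 = 0. Otherwise d is unchanged, and
  at most one cycle is gained against the growth of |S|.\<close>

lemma cycle_excess_insert: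
  assumes "\<beta> \<in> NC n" "S \<subseteq> {1..n}" "n \<in> S" "e \<in> {1..n}" "e \<notin> S"
  shows "cycle_excess n \<beta> (insert e S) \<le> cycle_excess n \<beta> S"
proof -
  note perm = NC_permutes[OF assms(1)]
  note part = partition_on_perm_cycles[OF perm]
  have fin: "finite S" using assms(2) finite_subset by blast
  have "e < n" using assms by (metis atLeastAtMost_iff order_le_less)
  let ?\<alpha> = "cyc_succ S"
  define q where "q = Min {y \<in> S. e < y}"
  have "q \<in> {y \<in> S. e < y}" unfolding q_def using fin assms \<open>e < n\<close> by (intro Min_in) auto
  then have q: "q \<in> S" by simp
  note \<alpha> = cyc_succ_permutes_superset[OF assms(2)]
  define p where "p = inv ?\<alpha> q"
  have p: "p \<in> S"
    using q permutes_in_image[OF permutes_inv[OF cyc_succ_permutes[OF fin]]] by (simp add: p_def)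
  have inv_outside: "inv ?\<alpha> x = x" if "x \<notin> S" for x
    using permutes_not_in[OF permutes_inv[OF cyc_succ_permutes[OF fin]] that] .
  have "inv (cyc_succ (insert e S)) = inv ?\<alpha> \<circ> transpose e q"
    unfolding cyc_succ_insert[OF assms(2,3,5) \<open>e < n\<close>] q_def[symmetric]
    by (subst o_inv_distrib) (simp_all add: permutes_bij[OF \<alpha>])
  \<comment> \<open>Moving the transposition to the left end makes the results on left
    multiplication applicable; \<open>inv ?\<alpha>\<close> sends q to p and fixes e.\<close>
  also have "\<dots> = transpose e p \<circ> inv ?\<alpha>"
  proof
    fix x
    have inj: "inj (inv ?\<alpha>)" using permutes_inj[OF permutes_inv[OF \<alpha>]] .
    have "inv ?\<alpha> (transpose e q x) = transpose (inv ?\<alpha> e) (inv ?\<alpha> q) (inv ?\<alpha> x)"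
      by (simp add: transpose_def inj_eq[OF inj])
    then show "(inv ?\<alpha> \<circ> transpose e q) x = (transpose e p \<circ> inv ?\<alpha>) x"
      by (simp add: p_def inv_outside[OF assms(5)])
  qed
  finally have comp: "inv (cyc_succ (insert e S)) \<circ> \<beta> = transpose e p \<circ> (inv ?\<alpha> \<circ> \<beta>)"
    by (simp add: comp_assoc)
  have \<pi>: "(inv ?\<alpha> \<circ> \<beta>) permutes {1..n}"
    by (intro permutes_compose perm permutes_inv \<alpha>)
  have pn: "p \<in> {1..n}" using p assms(2) by blast
  obtain C where C: "C \<in> perm_cycles n \<beta>" "e \<in> C"
    using assms(4) part partition_onD1 by blast
  have avoid: "e \<in> D \<longleftrightarrow> D = C" if "D \<in> perm_cycles n \<beta>" for D
    using partition_on_unique[OF part that C(1)] C(2) by blast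
  have cardS: "card (insert e S) = Suc (card S)" using fin assms(5) by simp
  have fin': "finite (blocks_avoiding n \<beta> S)" by (simp add: blocks_avoiding_def)
  show ?thesis
  proof (cases "C \<inter> S = {}")
    case True
    have orb\<beta>: "orbit \<beta> e = C"
      using C orbit_eqI_mem[OF perm] by (auto simp: perm_cycles_def)
    have "orbit (inv ?\<alpha> \<circ> \<beta>) e = orbit \<beta> e"
    proof (rule orbit_cong)
      fix s assume "s \<in> orbit \<beta> e"
      then have "\<beta> s \<in> C" using orb\<beta> by (metis orbit.step)
      then show "(inv ?\<alpha> \<circ> \<beta>) s = \<beta> s" using True inv_outside by auto
    qed (rule mem_orbit_self[OF perm])
    then have "p \<notin> orbit (inv ?\<alpha> \<circ> \<beta>) e" using orb\<beta> p True by blast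
    then have "Suc (card (perm_cycles n (inv (cyc_succ (insert e S)) \<circ> \<beta>))) = card (perm_cycles n (inv ?\<alpha> \<circ> \<beta>))"
      unfolding comp by (rule card_perm_cycles_transpose_merge[OF \<pi> assms(4) pn])
    moreover have "blocks_avoiding n \<beta> (insert e S) = blocks_avoiding n \<beta> S - {C}" "C \<in> blocks_avoiding n \<beta> S"
      using avoid C True by (auto simp: blocks_avoiding_def)
    then have "card (blocks_avoiding n \<beta> S) = Suc (card (blocks_avoiding n \<beta> (insert e S)))"
      using fin' by (metis card.remove)
    ultimately show ?thesis unfolding cycle_excess_def using cardS by linarith
  next
    case False
    have "card (perm_cycles n (inv (cyc_succ (insert e S)) \<circ> \<beta>)) \<le> Suc (card (perm_cycles n (inv ?\<alpha> \<circ> \<beta>)))"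
      unfolding comp by (rule card_perm_cycles_transpose_le[OF \<pi> assms(4) pn])
    moreover have "blocks_avoiding n \<beta> (insert e S) = blocks_avoiding n \<beta> S"
      using avoid False by (auto simp: blocks_avoiding_def)
    ultimately show ?thesis unfolding cycle_excess_def using cardS by simp
  qed
qed

lemma cycle_excess_antimono:
  assumes "\<beta> \<in> NC n" "n \<in> S" "S \<subseteq> T" "T \<subseteq> {1..n}"
  shows "cycle_excess n \<beta> T \<le> cycle_excess n \<beta> S"
proof -
  have S: "S \<subseteq> {1..n}" using assms by blast
  have "cycle_excess n \<beta> (S \<union> F) \<le> cycle_excess n \<beta> S"
    if "finite F" "F \<subseteq> {1..n}" "F \<inter> S = {}" for F
    using that
  proof (induction F rule: finite_induct)
    case (insert e F)
    have "cycle_excess n \<beta> (insert e (S \<union> F)) \<le> cycle_excess n \<beta> (S \<union> F)"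
      using insert.prems insert.hyps(2) assms(2) S by (intro cycle_excess_insert[OF assms(1)]) auto
    also have "\<dots> \<le> cycle_excess n \<beta> S"
      using insert.IH insert.prems by auto
    finally show ?case by simp
  qed simp
  moreover have "finite (T - S)" "T - S \<subseteq> {1..n}" "(T - S) \<inter> S = {}" "S \<union> (T - S) = T"
    using assms(3,4) finite_subset[OF assms(4)] by auto
  ultimately show ?thesis by metis
qed

text \<open>The excess does not increase when \<open>S\<close> grows, because every added element multiplies
  the permutation by one transposition. As it takes the same value at \<open>{n}\<close> and at \<open>{1..n}\<close>,
  it is constant.\<close>

lemma cycle_excess_eq:
  assumes "\<beta> \<in> NC n" "n \<in> S" "S \<subseteq> {1..n}"
  shows "cycle_excess n \<beta> S = 1 - int (card (perm_cycles n \<beta>))"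
proof -
  note perm = NC_permutes[OF assms(1)]
  note part = partition_on_perm_cycles[OF perm]
  have n: "n \<in> {1..n}" using assms by blast
  then obtain C where C: "C \<in> perm_cycles n \<beta>" "n \<in> C" using part partition_onD1 by blast
  have "blocks_avoiding n \<beta> {n} = perm_cycles n \<beta> - {C}"
    using partition_on_unique[OF part _ C(1)] C by (auto simp: blocks_avoiding_def)
  then have "Suc (card (blocks_avoiding n \<beta> {n})) = card (perm_cycles n \<beta>)"
    using C(1) by (metis card.remove finite_perm_cycles)
  moreover have "cyc_succ {n} = id" by (auto simp: cyc_succ_def)
  ultimately have low: "cycle_excess n \<beta> {n} = 1 - int (card (perm_cycles n \<beta>))"
    by (simp add: cycle_excess_def)
  have "C \<inter> {1..n} = C \<and> C \<noteq> {}" if "C \<in> perm_cycles n \<beta>" for C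
    using partition_onD1[OF part] partition_onD3[OF part] that by blast
  then have "blocks_avoiding n \<beta> {1..n} = {}"
    unfolding blocks_avoiding_def by blast
  \<comment> \<open>The cycle on {1..n} is the full cycle, so at this extreme the product is the
    inverse of the complement of \<beta>, whose cycles are already counted.\<close>
  moreover have "inv (cyc_succ {1..n}) \<circ> \<beta> = inv (kreweras n \<beta>)"
    unfolding kreweras_def full_cycle_eq[symmetric] using permutes_bij[OF perm] permutes_bij[OF full_cycle_permutes]
    by (subst o_inv_distrib) (simp_all add: bij_imp_bij_inv inv_inv_eq)
  ultimately have high: "cycle_excess n \<beta> {1..n} = 1 - int (card (perm_cycles n \<beta>))"
    using card_perm_cycles_kreweras[OF assms(1)] n
    by (simp add: cycle_excess_def perm_cycles_inv[OF kreweras_permutes[OF perm]])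
  show ?thesis
    using cycle_excess_antimono[OF assms(1), of "{n}" S] cycle_excess_antimono[OF assms(1), of S "{1..n}"]
      assms low high by simp
qed

lemma card_perm_cycles_cyc_succ:
  assumes "\<beta> \<in> NC n" "n \<in> S" "S \<subseteq> {1..n}"
  shows "card (perm_cycles n (inv (cyc_succ S) \<circ> \<beta>)) + card (perm_cycles n \<beta>) =
    card S + 1 + 2 * card (blocks_avoiding n \<beta> S)"
  using cycle_excess_eq[OF assms] by (simp add: cycle_excess_def)

subsection \<open>Complements of interval partitions\<close>

text \<open>S is the set of right endpoints. Applying \<alpha> after the cycle on S must give the
  full cycle: a point that is no endpoint is fixed by the cycle and moved up by \<alpha>; an
  endpoint x goes to the next endpoint, from which \<alpha> wraps around to the start x + 1 of that
  interval. From n this leads to the first interval and to 1.\<close>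

lemma kreweras_interval_partition:
  assumes Q: "partition_on {1..n} Q" and int: "\<forall>B\<in>Q. \<exists>a b. B = {a..b}" and n: "1 \<le> n"
  shows "Max ` Q \<subseteq> {1..n}" "n \<in> Max ` Q"
    and "kreweras n (perm_of_partition Q) = cyc_succ (Max ` Q)"
proof -
  let ?S = "Max ` Q" and ?\<alpha> = "perm_of_partition Q"
  have fin: "finite ?S" using finite_elements[OF _ Q] by simp
  have finB: "finite B" if "B \<in> Q" for B using partition_on_finite_block[OF Q _ that] by simp
  have ne: "B \<noteq> {}" if "B \<in> Q" for B using that Q by (auto simp: partition_on_def)
  have MaxB: "Max B \<in> B" if "B \<in> Q" for B using Max_in[OF finB ne] that by simp
  have sub: "B \<subseteq> {1..n}" if "B \<in> Q" for B using that Q by (auto simp: partition_on_def)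
  have conv: "y \<in> B" if B: "B \<in> Q" "x \<in> B" and "x \<le> y" "y \<le> Max B" for B x y
  proof -
    obtain a b where ab: "B = {a..b}" using int B by blast
    then have "Max B \<le> b" "a \<le> x" using MaxB[OF B(1)] B(2) by (metis atLeastAtMost_iff)+
    then have "y \<in> {a..b}" using that(3,4) by simp
    then show ?thesis by (simp only: ab)
  qed
  have blk: "\<exists>B\<in>Q. x \<in> B" if "x \<in> {1..n}" for x using that Q partition_onD1 by blast
  note uniq = partition_on_unique[OF Q]
  show S: "?S \<subseteq> {1..n}" using MaxB sub by blast
  obtain N where N: "N \<in> Q" "n \<in> N" using blk n by auto
  then have "Max N = n" using sub[OF N(1)] finB[OF N(1)] by (intro Max_eqI) auto
  then show nS: "n \<in> ?S" using N(1) by blast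
  have MaxS: "Max ?S = n" using nS S fin by (intro Max_eqI) auto
  have \<alpha>Max: "?\<alpha> (Max B) = Min B" if "B \<in> Q" for B
    using perm_of_partition_block[OF Q _ that MaxB[OF that]] cyc_succ_Max[OF finB ne] that by simp
  have next_block: "?\<alpha> (cyc_succ ?S x) = y"
    if C: "C \<in> Q" "y \<in> C" "y = Min C" and succ: "cyc_succ ?S x = Max C" for C x y
    using \<alpha>Max[OF C(1)] C succ by simp
  have "?\<alpha> (cyc_succ ?S x) = full_cycle n x" for x
  proof -
    consider "x \<notin> {1..n}" | "x = n" | "x \<in> {1..<n}" "x \<notin> ?S" | "x \<in> {1..<n}" "x \<in> ?S"
      by force
    then show ?thesis
    proof cases
      case 1
      then have "x \<notin> ?S" using S by blast
      then show ?thesis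
        using 1 permutes_not_in[OF full_cycle_permutes] perm_of_partition_outside[OF Q] by simp
    next
      case 2
      obtain C where C: "C \<in> Q" "1 \<in> C" using blk n by auto
      have "Min C = 1" using C sub[OF C(1)] finB[OF C(1)] by (intro Min_eqI) auto
      moreover have "Min ?S = Max C"
      proof (rule Min_eqI[OF fin])
        fix y assume "y \<in> ?S"
        then obtain D where D: "D \<in> Q" "y = Max D" by blast
        have "y \<in> C" if "y < Max C"
          using conv[OF C, of y] S \<open>y \<in> ?S\<close> that by auto
        then have "y < Max C \<Longrightarrow> C = D" using uniq[OF C(1) D(1)] MaxB[OF D(1)] D(2) by simp
        then show "Max C \<le> y" using D(2) by (metis leI less_irrefl)
      qed (use C in blast)
      moreover have "?S \<noteq> {}" using nS by blast
      ultimately show ?thesis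
        using next_block[OF C] cyc_succ_Max[OF fin] MaxS 2 n by (simp add: full_cycle_last)
    next
      case 3
      then obtain B where B: "B \<in> Q" "x \<in> B" using blk[of x] by auto
      have "x \<noteq> Max B" using 3 B by blast
      then have "x < Max B" using B finB by (meson Max_ge order_less_le)
      then have "Suc x \<in> B" using conv[OF B, of "Suc x"] by simp
      then have "cyc_succ B x = Suc x" using B finB by (intro cyc_succ_eqI) auto
      then show ?thesis
        using 3 perm_of_partition_block[OF Q _ B] full_cycle_less[of x n] by simp
    next
      case 4
      then obtain B where B: "B \<in> Q" "x = Max B" by blast
      obtain C where C: "C \<in> Q" "Suc x \<in> C" using blk[of "Suc x"] 4 by auto
      have "x \<notin> C"
      proof
        assume "x \<in> C"
        then have "B = C" using uniq[OF B(1) C(1)] MaxB B by blast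
        then show False using C(2) B Max_ge[OF finB[OF C(1)] C(2)] by simp
      qed
      have le: "Suc x \<le> Max C" using finB C by simp
      have "Min C = Suc x"
      proof (rule Min_eqI[OF finB[OF C(1)]])
        fix y assume y: "y \<in> C"
        have "y \<le> x \<Longrightarrow> x \<in> C" using conv[OF C(1) y, of x] le by simp
        then show "Suc x \<le> y" using \<open>x \<notin> C\<close> by (metis not_less_eq_eq)
      qed (use C in simp)
      moreover have "cyc_succ ?S x = Max C"
      proof (rule cyc_succ_eqI[OF fin])
        show "x \<in> ?S" "Max C \<in> ?S" "x < Max C" using 4 C le by auto
        fix z assume "z \<in> ?S" "x < z"
        then obtain D where D: "D \<in> Q" "z = Max D" by blast
        have "z < Max C \<Longrightarrow> z \<in> C" using conv[OF C, of z] \<open>x < z\<close> by simp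
        then have "z < Max C \<Longrightarrow> C = D" using uniq[OF C(1) D(1)] MaxB[OF D(1)] D(2) by simp
        then show "Max C \<le> z" using D(2) by (metis leI less_irrefl)
      qed
      ultimately show ?thesis
        using next_block[OF C] 4 full_cycle_less[of x n] by simp
    qed
  qed
  then have "inv ?\<alpha> (full_cycle n x) = cyc_succ ?S x" for x
    using permutes_inverses(2)[OF perm_of_partition_permutes[OF Q]] by (metis finite_atLeastAtMost)
  then show "kreweras n ?\<alpha> = cyc_succ ?S" by (simp add: kreweras_def fun_eq_iff)
qed

text \<open>Points are grouped by the first element of S at or after them, which exists because n is
  in S. Each group is an interval ending in its element of S.\<close>

lemma ex_interval_partition:
  fixes n :: nat
  assumes "S \<subseteq> {1..n}" "n \<in> S"
  shows "\<exists>Q. partition_on {1..n} Q \<and> (\<forall>B\<in>Q. \<exists>a b. B = {a..b}) \<and> Max ` Q = S"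
proof -
  have fin: "finite S" using assms(1) finite_subset by blast
  define f where "f x = Min {t \<in> S. x \<le> t}" for x
  define D where "D s = {x \<in> {1..n}. f x = s}" for s
  have f: "f x \<in> S" "x \<le> f x" if "x \<le> n" for x
  proof -
    have "f x \<in> {t \<in> S. x \<le> t}" unfolding f_def using fin assms(2) that by (intro Min_in) auto
    then show "f x \<in> S" "x \<le> f x" by auto
  qed
  have f_le: "f x \<le> t" if "t \<in> S" "x \<le> t" for x t unfolding f_def using fin that by simp
  have fS: "f s = s" if "s \<in> S" for s using f[of s] f_le[of s s] that assms(1) by fastforce
  have sD: "s \<in> D s" if "s \<in> S" for s using that fS assms(1) by (auto simp: D_def)
  have Max: "Max (D s) = s" if "s \<in> S" for s
    using sD[OF that] f by (intro Max_eqI) (auto simp: D_def)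
  have int: "D s = {Min (D s)..s}" if s: "s \<in> S" for s
  proof
    have finD: "finite (D s)" by (simp add: D_def)
    show "D s \<subseteq> {Min (D s)..s}" using f finD by (auto simp: D_def)
    have m: "Min (D s) \<in> D s" using sD[OF s] finD by (intro Min_in) auto
    show "{Min (D s)..s} \<subseteq> D s"
    proof
      fix x assume x: "x \<in> {Min (D s)..s}"
      have "s \<le> n" using s assms(1) by auto
      then have "f (Min (D s)) \<le> f x" using f[of x] x by (intro f_le) auto
      moreover have "f (Min (D s)) = s" "1 \<le> Min (D s)" using m by (auto simp: D_def)
      moreover have "f x \<le> s" using x s by (intro f_le) auto
      ultimately show "x \<in> D s" using x \<open>s \<le> n\<close> unfolding D_def by auto
    qed
  qed
  have "partition_on {1..n} (D ` S)"
  proof (rule partition_onI)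
    show "\<Union>(D ` S) = {1..n}" using f(1) by (auto simp: D_def)
    show "{} \<notin> D ` S" using sD by blast
  qed (auto simp: D_def disjnt_def)
  moreover have "\<forall>B\<in>D ` S. \<exists>a b. B = {a..b}" using int by blast
  moreover have "Max ` D ` S = S" using Max by (simp add: image_image)
  ultimately show ?thesis by blast
qed

lemma KrInt_eq:
  assumes "1 \<le> n"
  shows "KrInt n = cyc_succ ` {S. S \<subseteq> {1..n} \<and> n \<in> S}"
proof (intro set_eqI iffI)
  fix \<alpha> assume "\<alpha> \<in> KrInt n"
  then obtain Q where Q: "partition_on {1..n} Q" "\<forall>B\<in>Q. \<exists>a b. B = {a..b}"
    "\<alpha> = kreweras n (perm_of_partition Q)"
    by (auto simp: KrInt_def Int_part_def interval_partitions_def)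
  then show "\<alpha> \<in> cyc_succ ` {S. S \<subseteq> {1..n} \<and> n \<in> S}"
    using kreweras_interval_partition[OF Q(1,2) assms] by simp
next
  fix \<alpha> assume "\<alpha> \<in> cyc_succ ` {S. S \<subseteq> {1..n} \<and> n \<in> S}"
  then obtain S where S: "S \<subseteq> {1..n}" "n \<in> S" "\<alpha> = cyc_succ S" by blast
  then obtain Q where Q: "partition_on {1..n} Q" "\<forall>B\<in>Q. \<exists>a b. B = {a..b}" "Max ` Q = S"
    using ex_interval_partition by metis
  then have "\<alpha> = kreweras n (perm_of_partition Q)"
    using kreweras_interval_partition(3)[OF Q(1,2) assms] S(3) by simp
  then show "\<alpha> \<in> KrInt n"
    using Q(1,2) by (auto simp: KrInt_def Int_part_def interval_partitions_def)
qed

text \<open>S is recovered as the orbit of n. Fixing n as a member excludes the empty set and the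
  other singletons, all of which give the identity.\<close>

lemma inj_on_cyc_succ: "inj_on cyc_succ {S. S \<subseteq> {1..n} \<and> n \<in> S}"
proof (rule inj_onI)
  fix S T assume h: "S \<in> {S. S \<subseteq> {1..n} \<and> n \<in> S}" "T \<in> {S. S \<subseteq> {1..n} \<and> n \<in> S}" "cyc_succ S = cyc_succ T"
  then have "S \<subseteq> {1..n}" "T \<subseteq> {1..n}" by simp_all
  then have "finite S" "finite T" by (simp_all add: finite_subset[OF _ finite_atLeastAtMost, of _ 1 n])
  then have "orbit (cyc_succ S) n = S" "orbit (cyc_succ T) n = T" using h(1,2) by (simp_all add: orbit_cyc_succ)
  then show "S = T" using h(3) by metis
qed

lemma Int_part_permutes: "\<sigma> \<in> Int_part n \<Longrightarrow> \<sigma> permutes {1..n}"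
  by (auto simp: Int_part_def interval_partitions_def intro!: perm_of_partition_permutes)

text \<open>All cycles of \<open>cyc_succ R\<close> other than R are singletons and fit into any
  partition; R contains n, so it can only fit into the cycle of n.\<close>

lemma refines_cyc_succ_iff:
  assumes "\<sigma> permutes {1..n}" "R \<subseteq> {1..n}" "n \<in> R"
  shows "refines n (cyc_succ R) \<sigma> \<longleftrightarrow> R \<subseteq> orbit \<sigma> n"
proof
  have fin: "finite R" using assms(2) finite_subset by blast
  {
    assume "refines n (cyc_succ R) \<sigma>"
    moreover have "R \<in> perm_cycles n (cyc_succ R)"
      using orbit_cyc_succ[OF fin assms(3)] assms(2,3) by (auto simp: perm_cycles_def)
    ultimately obtain x where "R \<subseteq> orbit \<sigma> x" by (auto simp: refines_def perm_cycles_def)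
    then show "R \<subseteq> orbit \<sigma> n" using orbit_eqI_mem[OF assms(1)] assms(3) by (metis subsetD)
  next
    assume R: "R \<subseteq> orbit \<sigma> n"
    have "\<exists>C\<in>perm_cycles n \<sigma>. orbit (cyc_succ R) x \<subseteq> C" if x: "x \<in> {1..n}" for x
    proof (cases "x \<in> R")
      case True
      then show ?thesis
        using R orbit_cyc_succ[OF fin True] assms(2,3) by (auto simp: perm_cycles_def)
    next
      case False
      then have "orbit (cyc_succ R) x = {x}" by (simp add: orbit_eq_singleton_iff)
      then show ?thesis using x mem_orbit_self[OF assms(1), of x] by (auto simp: perm_cycles_def)
    qed
    then show "refines n (cyc_succ R) \<sigma>" by (auto simp: refines_def perm_cycles_def)
  }
qed

text \<open>The common lower bounds are the cycles on sets T with n \<in> T inside the intersection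
  of S with the orbit of n, and refinement between them is inclusion.\<close>

lemma KrInt_meet_cyc_succ:
  assumes "S \<subseteq> {1..n}" "n \<in> S" "\<beta> permutes {1..n}"
  shows "KrInt_meet n (cyc_succ S) \<beta> = cyc_succ (S \<inter> orbit \<beta> n)"
proof -
  have n: "1 \<le> n" using assms by auto
  have fin: "finite S" using assms(1) finite_subset by blast
  let ?R = "S \<inter> orbit \<beta> n"
  have orb: "n \<in> orbit \<beta> n" using mem_orbit_self[OF assms(3)] .
  have perm: "cyc_succ T permutes {1..n}" "orbit (cyc_succ T) n = T" if "T \<subseteq> {1..n}" "n \<in> T" for T
    by (rule cyc_succ_permutes_superset[OF that(1)])
      (rule orbit_cyc_succ[OF finite_subset[OF that(1)] that(2)], simp)
  let ?L = "{\<rho> \<in> KrInt n. refines n \<rho> (cyc_succ S) \<and> refines n \<rho> \<beta>}"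
  have L: "?L = cyc_succ ` {T. T \<subseteq> ?R \<and> n \<in> T}"
  proof (intro set_eqI iffI)
    fix \<rho> assume \<rho>: "\<rho> \<in> ?L"
    then obtain T where T: "T \<subseteq> {1..n}" "n \<in> T" "\<rho> = cyc_succ T" by (auto simp: KrInt_eq[OF n])
    then have "T \<subseteq> ?R"
      using \<rho> refines_cyc_succ_iff[OF assms(3) T(1,2)]
        refines_cyc_succ_iff[OF perm(1)[OF assms(1,2)] T(1,2)] perm(2)[OF assms(1,2)] by simp
    then show "\<rho> \<in> cyc_succ ` {T. T \<subseteq> ?R \<and> n \<in> T}" using T by blast
  next
    fix \<rho> assume "\<rho> \<in> cyc_succ ` {T. T \<subseteq> ?R \<and> n \<in> T}"
    then obtain T where T: "T \<subseteq> ?R" "n \<in> T" "\<rho> = cyc_succ T" by blast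
    then have T': "T \<subseteq> {1..n}" using assms(1) by blast
    then have "\<rho> \<in> KrInt n" using T by (auto simp: KrInt_eq[OF n])
    then show "\<rho> \<in> ?L"
      using T refines_cyc_succ_iff[OF assms(3) T' T(2)]
        refines_cyc_succ_iff[OF perm(1)[OF assms(1,2)] T' T(2)] perm(2)[OF assms(1,2)] by simp
  qed
  have R: "?R \<subseteq> {1..n}" "n \<in> ?R" using assms orb by auto
  \<comment> \<open>An equivalence for arbitrary \<rho>, so that it rewrites the body of the
    definite description to an equation.\<close>
  have greatest: "(\<rho> \<in> ?L \<and> (\<forall>\<tau>\<in>?L. refines n \<tau> \<rho>)) \<longleftrightarrow> \<rho> = cyc_succ ?R" for \<rho>
  proof
    assume h: "\<rho> \<in> ?L \<and> (\<forall>\<tau>\<in>?L. refines n \<tau> \<rho>)"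
    then obtain T where T: "T \<subseteq> ?R" "n \<in> T" "\<rho> = cyc_succ T" unfolding L by blast
    then have T': "T \<subseteq> {1..n}" using assms(1) by blast
    have "cyc_succ ?R \<in> ?L" unfolding L using R by blast
    then have "refines n (cyc_succ ?R) \<rho>" using h by blast
    then have "?R \<subseteq> T"
      unfolding T(3) refines_cyc_succ_iff[OF perm(1)[OF T' T(2)] R] perm(2)[OF T' T(2)] .
    then show "\<rho> = cyc_succ ?R" using T by (simp add: subset_antisym)
  next
    assume \<rho>: "\<rho> = cyc_succ ?R"
    have "refines n (cyc_succ T) \<rho>" if "T \<subseteq> ?R" "n \<in> T" for T
    proof -
      have T': "T \<subseteq> {1..n}" using that R(1) by blast
      show ?thesis
        unfolding \<rho> refines_cyc_succ_iff[OF perm(1)[OF R] T' that(2)] perm(2)[OF R] by (rule that)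
    qed
    then show "\<rho> \<in> ?L \<and> (\<forall>\<tau>\<in>?L. refines n \<tau> \<rho>)" unfolding L \<rho> using R by blast
  qed
  show ?thesis unfolding KrInt_meet_def Let_def greatest by simp
qed

lemma KrInt_meet_eq_id_iff:
  assumes "S \<subseteq> {1..n}" "n \<in> S" "\<beta> permutes {1..n}"
  shows "KrInt_meet n (cyc_succ S) \<beta> = id \<longleftrightarrow> S \<inter> orbit \<beta> n = {n}"
proof -
  have id: "id = cyc_succ {n}" by (auto simp: cyc_succ_def)
  have "n \<in> S \<inter> orbit \<beta> n" "S \<inter> orbit \<beta> n \<subseteq> {1..n}" "{n} \<subseteq> {1..n}"
    using assms mem_orbit_self[OF assms(3), of n] by auto
  then show ?thesis
    unfolding KrInt_meet_cyc_succ[OF assms] id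
    using inj_onD[OF inj_on_cyc_succ, of "S \<inter> orbit \<beta> n" "{n}"] by auto
qed

subsection \<open>Factorisation of the weights\<close>

text \<open>A subset of a disjoint union amounts to an independent choice of its trace on each
  member. The factor may depend on the member, which allows one block to be treated
  specially.\<close>

lemma sum_Pow_Union_prod:
  fixes f :: "'a set \<Rightarrow> 'a set \<Rightarrow> 'b::comm_ring_1"
  assumes "finite P" "disjoint P" "\<And>c. c \<in> P \<Longrightarrow> finite c"
  shows "(\<Sum>S\<in>Pow (\<Union>P). \<Prod>c\<in>P. f c (S \<inter> c)) = (\<Prod>c\<in>P. \<Sum>T\<in>Pow c. f c T)"
  using assms
proof (induction P rule: finite_induct)
  case (insert c P)
  let ?U = "\<Union>P"
  have disj: "c \<inter> d = {}" if "d \<in> P" for d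
    using insert.prems(1) insert.hyps(2) that by (auto simp: pairwise_insert disjnt_def)
  then have cU: "c \<inter> ?U = {}" by blast
  have IH: "(\<Sum>S\<in>Pow ?U. \<Prod>d\<in>P. f d (S \<inter> d)) = (\<Prod>d\<in>P. \<Sum>T\<in>Pow d. f d T)"
    using insert.prems by (intro insert.IH) (auto simp: pairwise_insert)
  have "(\<Sum>S\<in>Pow (\<Union>(insert c P)). \<Prod>d\<in>insert c P. f d (S \<inter> d)) =
      (\<Sum>(T, R)\<in>Pow c \<times> Pow ?U. f c T * (\<Prod>d\<in>P. f d (R \<inter> d)))"
  proof (rule sum.reindex_bij_witness[where i = "\<lambda>(T, R). T \<union> R" and j = "\<lambda>S. (S \<inter> c, S \<inter> ?U)"])
    fix S assume "S \<in> Pow (\<Union>(insert c P))"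
    have "(S \<inter> ?U) \<inter> d = S \<inter> d" if "d \<in> P" for d using that by blast
    then show "(case (S \<inter> c, S \<inter> ?U) of (T, R) \<Rightarrow> f c T * (\<Prod>d\<in>P. f d (R \<inter> d))) =
        (\<Prod>d\<in>insert c P. f d (S \<inter> d))"
      using insert.hyps by simp
  qed (use cU in auto)
  also have "\<dots> = (\<Sum>T\<in>Pow c. f c T) * (\<Sum>R\<in>Pow ?U. \<Prod>d\<in>P. f d (R \<inter> d))"
    by (simp add: sum_product sum.cartesian_product)
  finally show ?case using IH insert.hyps by simp
qed simp

lemma sum_Pow_power_card:
  fixes x :: "'b::comm_ring_1"
  assumes "finite A"
  shows "(\<Sum>T\<in>Pow A. x ^ card (A - T)) = (1 + x) ^ card A"
  using prod_add[OF assms, of "\<lambda>_. 1" "\<lambda>_. x"] by simp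

lemma Yv_nonzero [simp]: "Yv \<noteq> 0"
  by (simp add: Yv_def Zero_fract_def eq_fract)

text \<open>Contribution of a block c other than V when S meets it in T: BY for the block, AY for
  each point outside S, and Y^{-2} if the block avoids S.\<close>

definition block_weight :: "'a set \<Rightarrow> 'a set \<Rightarrow> coeff" where
  "block_weight c T = Bv * Yv * (Av * Yv) ^ card (c - T) * (if T = {} then inverse (Yv ^ 2) else 1)"

text \<open>Without the case T = {} the sum is binomial and yields (1 + AY)^|c|; correcting that
  single term gives the second summand of g.\<close>

lemma sum_block_weight:
  assumes "finite c"
  shows "(\<Sum>T\<in>Pow c. block_weight c T) = g_seq (card c)"
proof -
  let ?x = "Av * Yv"
  have "block_weight c T = Bv * Yv *
      (?x ^ card (c - T) + (if T = {} then ?x ^ card c * (inverse (Yv ^ 2) - 1) else 0))" for T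
    by (simp add: block_weight_def algebra_simps)
  then have "(\<Sum>T\<in>Pow c. block_weight c T) = Bv * Yv * ((\<Sum>T\<in>Pow c. ?x ^ card (c - T)) +
      (\<Sum>T\<in>Pow c. if T = {} then ?x ^ card c * (inverse (Yv ^ 2) - 1) else 0))"
    by (simp only: sum_distrib_left[symmetric] sum.distrib)
  also have "(\<Sum>T\<in>Pow c. if T = {} then ?x ^ card c * (inverse (Yv ^ 2) - 1) else 0) =
      ?x ^ card c * (inverse (Yv ^ 2) - 1)"
    using assms by (simp add: sum.delta')
  finally show ?thesis using assms by (simp add: g_seq_def sum_Pow_power_card)
qed

definition meander_weight :: "nat \<Rightarrow> (nat \<Rightarrow> nat) \<Rightarrow> (nat \<Rightarrow> nat) \<Rightarrow> coeff" where
  "meander_weight n \<alpha> \<beta> = Yv ^ perm_length n (inv \<alpha> \<circ> \<beta>) *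
     Av ^ perm_length n (inv \<alpha> \<circ> full_cycle n) * Bv ^ perm_length n (inv \<beta> \<circ> full_cycle n)"

text \<open>Allows the cycle count to be applied with the full cycle in place of \<beta>, which
  yields the exponent of A. Its only weak descent is at n, where the interval is all of
  {1..n}.\<close>

lemma full_cycle_NC: "1 \<le> n \<Longrightarrow> full_cycle n \<in> NC n"
proof (rule NC_I)
  fix x z assume "x \<in> {1..n}" "full_cycle n x \<le> x" "z \<in> {full_cycle n x..x}" "1 \<le> n"
  moreover from this have "x = n" using full_cycle_less[of x n] by force
  moreover from calculation have "z \<in> {1..n}" using full_cycle_last[of n] by simp
  then have "full_cycle n z \<in> {1..n}" by (simp only: permutes_in_image[OF full_cycle_permutes])
  ultimately show "full_cycle n z \<in> {full_cycle n x..x}" using full_cycle_last[of n] by simp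
qed (rule full_cycle_permutes)

lemma perm_cycles_full_cycle: "1 \<le> n \<Longrightarrow> perm_cycles n (full_cycle n) = {{1..n}}"
  unfolding perm_cycles_def full_cycle_eq using orbit_cyc_succ[of "{1..n}"] by (auto simp: image_constant_conv)

lemma perm_length_cyc_succ_full_cycle:
  assumes "n \<in> S" "S \<subseteq> {1..n}"
  shows "perm_length n (inv (cyc_succ S) \<circ> full_cycle n) = n - card S"
proof -
  have n: "1 \<le> n" using assms by auto
  have "blocks_avoiding n (full_cycle n) S = {}"
    unfolding blocks_avoiding_def perm_cycles_full_cycle[OF n] using assms by blast
  then show ?thesis
    using card_perm_cycles_cyc_succ[OF full_cycle_NC[OF n] assms]
    by (simp add: perm_length_def perm_cycles_full_cycle[OF n])
qed

lemma perm_length_kreweras: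
  assumes "\<beta> \<in> NC n" "1 \<le> n"
  shows "perm_length n (inv \<beta> \<circ> full_cycle n) = card (perm_cycles n \<beta>) - 1"
  using card_perm_cycles_kreweras[OF assms] card_perm_cycles_le[of n \<beta>]
  by (simp add: perm_length_def kreweras_def)

text \<open>The block V of n carries no factor BY, because the exponent of B is #\<beta> - 1, and no
  factor Y^{-2}, because n \<in> S.\<close>

lemma meander_weight_eq:
  assumes "\<beta> \<in> NC n" "n \<in> S" "S \<subseteq> {1..n}"
  shows "meander_weight n (cyc_succ S) \<beta> = (Av * Yv) ^ card (orbit \<beta> n - S) *
    (\<Prod>c\<in>perm_cycles n \<beta> - {orbit \<beta> n}. block_weight c (S \<inter> c))"
proof -
  note perm = NC_permutes[OF assms(1)]
  note part = partition_on_perm_cycles[OF perm]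
  have n: "n \<in> {1..n}" "1 \<le> n" using assms by auto
  define P where "P = perm_cycles n \<beta>"
  define V where "V = orbit \<beta> n"
  define D where "D = blocks_avoiding n \<beta> S"
  have finP: "finite P" by (simp add: P_def)
  have V: "V \<in> P" "n \<in> V" using n mem_orbit_self[OF perm] by (auto simp: V_def P_def perm_cycles_def)
  have finc: "finite c" if "c \<in> P" for c
    using partition_on_finite_block[OF part _ that[unfolded P_def]] by simp
  have D: "D = {c \<in> P - {V}. S \<inter> c = {}}"
    using V assms(2) by (auto simp: D_def blocks_avoiding_def P_def)
  have finS: "finite S" using assms(3) finite_subset by blast
  have disj: "(c - S) \<inter> (d - S) = {}" if "c \<in> P" "d \<in> P" "c \<noteq> d" for c d
    using partition_on_unique[OF part that(1,2)[unfolded P_def]] that(3) by blast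
  have "(\<Sum>c\<in>P. card (c - S)) = card (\<Union>c\<in>P. c - S)"
    using finP finc disj by (intro card_UN_disjoint[symmetric]) auto
  also have "(\<Union>c\<in>P. c - S) = {1..n} - S" using partition_onD1[OF part] by (auto simp: P_def)
  finally have sumc: "(\<Sum>c\<in>P. card (c - S)) = n - card S"
    using assms(3) finS by (simp add: card_Diff_subset)
  have "c - S \<inter> c = c - S" for c by blast
  then have "(\<Prod>c\<in>P - {V}. block_weight c (S \<inter> c)) =
      (\<Prod>c\<in>P - {V}. Bv * Yv) * (\<Prod>c\<in>P - {V}. (Av * Yv) ^ card (c - S)) *
      (\<Prod>c\<in>P - {V}. if S \<inter> c = {} then inverse (Yv ^ 2) else 1)"
    by (simp only: block_weight_def prod.distrib)
  also have "(\<Prod>c\<in>P - {V}. if S \<inter> c = {} then inverse (Yv ^ 2) else 1) = inverse (Yv ^ 2) ^ card D"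
    unfolding D using finP by (simp add: prod.If_cases Int_def)
  also have "(\<Prod>c\<in>P - {V}. Bv * Yv) = (Bv * Yv) ^ (card P - 1)"
    using finP V by simp
  finally have "(Av * Yv) ^ card (V - S) * (\<Prod>c\<in>P - {V}. block_weight c (S \<inter> c)) =
      ((Av * Yv) ^ card (V - S) * (\<Prod>c\<in>P - {V}. (Av * Yv) ^ card (c - S))) *
      (Bv * Yv) ^ (card P - 1) * inverse (Yv ^ 2) ^ card D"
    by (simp add: mult_ac)
  also have "(Av * Yv) ^ card (V - S) * (\<Prod>c\<in>P - {V}. (Av * Yv) ^ card (c - S)) = (Av * Yv) ^ (n - card S)"
    unfolding sumc[symmetric] power_sum using prod.remove[OF finP V(1)] by metis
  finally have rhs: "(Av * Yv) ^ card (V - S) * (\<Prod>c\<in>P - {V}. block_weight c (S \<inter> c)) =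
      (Av * Yv) ^ (n - card S) * (Bv * Yv) ^ (card P - 1) * inverse (Yv ^ 2) ^ card D" .
  have cardP: "card P \<ge> 1" using V finP by (metis One_nat_def Suc_leI card_gt_0_iff empty_iff)
  let ?e = "perm_length n (inv (cyc_succ S) \<circ> \<beta>)"
  have "card S \<le> n" using card_mono[OF _ assms(3)] by simp
  \<comment> \<open>The cycle count written additively over the naturals; the 2 d on the left
    becomes Y^{-2} to the power d after division in the field.\<close>
  then have "?e + 2 * card D = (n - card S) + (card P - 1)"
    using card_perm_cycles_cyc_succ[OF assms] card_perm_cycles_le[of n "inv (cyc_succ S) \<circ> \<beta>"] cardP
    unfolding perm_length_def P_def[symmetric] D_def[symmetric] by linarith
  then have "Yv ^ ?e * (Yv ^ 2) ^ card D = Yv ^ (n - card S) * Yv ^ (card P - 1)"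
    by (simp only: power_add[symmetric] power_mult[symmetric])
  then have "Yv ^ ?e = Yv ^ (n - card S) * Yv ^ (card P - 1) * inverse (Yv ^ 2) ^ card D"
    by (simp add: field_simps power_inverse)
  then show ?thesis
    unfolding P_def[symmetric] V_def[symmetric] rhs meander_weight_def
      perm_length_cyc_succ_full_cycle[OF assms(2,3)] perm_length_kreweras[OF assms(1) n(2)]
    by (simp add: power_mult_distrib mult_ac)
qed

text \<open>\<open>\<T>\<close> is the set of admissible traces of S on the block of n: only {n} for
  K, every subset containing n for M.\<close>

lemma sum_meander_weight:
  assumes "\<beta> \<in> NC n" "n \<in> {1..n}" "\<T> \<subseteq> {T \<in> Pow (orbit \<beta> n). n \<in> T}"
  shows "(\<Sum>S | S \<subseteq> {1..n} \<and> S \<inter> orbit \<beta> n \<in> \<T>. meander_weight n (cyc_succ S) \<beta>) =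
    (\<Sum>T\<in>\<T>. (Av * Yv) ^ card (orbit \<beta> n - T)) *
    (\<Prod>c\<in>perm_cycles n \<beta> - {orbit \<beta> n}. g_seq (card c))"
proof -
  note perm = NC_permutes[OF assms(1)]
  note part = partition_on_perm_cycles[OF perm]
  define P where "P = perm_cycles n \<beta>"
  define V where "V = orbit \<beta> n"
  have finP: "finite P" by (simp add: P_def)
  have V: "V \<in> P" using assms(2) by (auto simp: V_def P_def perm_cycles_def)
  have U: "\<Union>P = {1..n}" using partition_onD1[OF part] by (simp add: P_def)
  have finc: "finite c" if "c \<in> P" for c
    using partition_on_finite_block[OF part _ that[unfolded P_def]] by simp
  \<comment> \<open>The factor at V vanishes outside \<open>\<T>\<close>; this moves the constraint
    on S into the summand, so that the sum may run over all subsets.\<close>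
  define F where "F c T = (if c = V then if T \<in> \<T> then (Av * Yv) ^ card (V - T) else 0 else block_weight c T)" for c T
  have prodF: "(\<Prod>c\<in>P. F c (S \<inter> c)) = F V (S \<inter> V) * (\<Prod>c\<in>P - {V}. block_weight c (S \<inter> c))" for S
    using prod.remove[OF finP V, of "\<lambda>c. F c (S \<inter> c)"] by (simp add: F_def)
  have "(\<Sum>S | S \<subseteq> {1..n} \<and> S \<inter> V \<in> \<T>. meander_weight n (cyc_succ S) \<beta>) =
      (\<Sum>S | S \<subseteq> {1..n} \<and> S \<inter> V \<in> \<T>. \<Prod>c\<in>P. F c (S \<inter> c))"
  proof (rule sum.cong)
    fix S assume S: "S \<in> {S. S \<subseteq> {1..n} \<and> S \<inter> V \<in> \<T>}"
    then have "n \<in> S" using assms(3) by (auto simp: V_def)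
    moreover have "V - S \<inter> V = V - S" by blast
    ultimately show "meander_weight n (cyc_succ S) \<beta> = (\<Prod>c\<in>P. F c (S \<inter> c))"
      using S meander_weight_eq[OF assms(1)] unfolding prodF by (simp add: F_def V_def P_def)
  qed simp
  also have "\<dots> = (\<Sum>S\<in>Pow (\<Union>P). \<Prod>c\<in>P. F c (S \<inter> c))"
  proof (unfold U, rule sum.mono_neutral_left)
    show "\<forall>S\<in>Pow {1..n} - {S. S \<subseteq> {1..n} \<and> S \<inter> V \<in> \<T>}. (\<Prod>c\<in>P. F c (S \<inter> c)) = 0"
      unfolding prodF by (simp add: F_def)
  qed auto
  also have "\<dots> = (\<Prod>c\<in>P. \<Sum>T\<in>Pow c. F c T)"
    using part finP finc by (intro sum_Pow_Union_prod) (auto simp: P_def partition_on_def)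
  also have "\<dots> = (\<Sum>T\<in>Pow V. F V T) * (\<Prod>c\<in>P - {V}. \<Sum>T\<in>Pow c. F c T)"
    by (rule prod.remove[OF finP V])
  also have "(\<Sum>T\<in>Pow V. F V T) = (\<Sum>T\<in>\<T>. (Av * Yv) ^ card (V - T))"
    using assms(3) finc[OF V] by (intro sum.mono_neutral_cong_right) (auto simp: F_def V_def)
  also have "(\<Prod>c\<in>P - {V}. \<Sum>T\<in>Pow c. F c T) = (\<Prod>c\<in>P - {V}. g_seq (card c))"
    using finc by (intro prod.cong refl) (simp add: F_def sum_block_weight)
  finally show ?thesis unfolding P_def V_def .
qed

text \<open>Common form of the coefficients of K and M, which differ only in the weight f of the
  block of n.\<close>

definition NC_sum :: "(nat \<Rightarrow> coeff) \<Rightarrow> nat \<Rightarrow> coeff" where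
  "NC_sum f n = (\<Sum>\<beta>\<in>NC n. f (card (orbit \<beta> n)) *
     (\<Prod>c\<in>perm_cycles n \<beta> - {orbit \<beta> n}. g_seq (card c)))"

lemma K_series_nth:
  assumes "1 \<le> n"
  shows "fps_nth K_series n = NC_sum h_seq n"
proof -
  \<comment> \<open>The meet condition is written as membership in \<open>{{n}}\<close> to match
    \<open>sum_meander_weight\<close>; it already forces n \<in> S.\<close>
  let ?A = "SIGMA \<beta>:NC n. {S. S \<subseteq> {1..n} \<and> S \<inter> orbit \<beta> n \<in> {{n}}}"
  let ?B = "{(\<alpha>, \<beta>). \<alpha> \<in> KrInt n \<and> \<beta> \<in> NC n \<and> KrInt_meet n \<alpha> \<beta> = id}"
  have n: "n \<in> {1..n}" using assms by simp
  have "?B = (\<lambda>(\<beta>, S). (cyc_succ S, \<beta>)) ` ?A"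
  proof (intro set_eqI iffI)
    fix z assume "z \<in> ?B"
    then obtain S \<beta> where "z = (cyc_succ S, \<beta>)" "S \<subseteq> {1..n}" "n \<in> S" "\<beta> \<in> NC n" "KrInt_meet n (cyc_succ S) \<beta> = id"
      by (auto simp: KrInt_eq[OF assms])
    then show "z \<in> (\<lambda>(\<beta>, S). (cyc_succ S, \<beta>)) ` ?A"
      using KrInt_meet_eq_id_iff[of S n \<beta>] NC_permutes[of \<beta> n] by force
  next
    fix z assume "z \<in> (\<lambda>(\<beta>, S). (cyc_succ S, \<beta>)) ` ?A"
    then obtain S \<beta> where "z = (cyc_succ S, \<beta>)" "S \<subseteq> {1..n}" "S \<inter> orbit \<beta> n = {n}" "\<beta> \<in> NC n" by auto
    moreover from this have "n \<in> S" by blast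
    ultimately show "z \<in> ?B"
      using KrInt_meet_eq_id_iff[of S n \<beta>] NC_permutes[of \<beta> n] by (auto simp: KrInt_eq[OF assms])
  qed
  moreover have "inj_on (\<lambda>(\<beta>, S). (cyc_succ S, \<beta>)) ?A"
  proof (rule inj_onI)
    fix y z assume h: "y \<in> ?A" "z \<in> ?A" "(\<lambda>(\<beta>, S). (cyc_succ S, \<beta>)) y = (\<lambda>(\<beta>, S). (cyc_succ S, \<beta>)) z"
    then obtain \<beta> S T where yz: "y = (\<beta>, S)" "z = (\<beta>, T)" "cyc_succ S = cyc_succ T" by (cases y; cases z) auto
    then have "S \<in> {S. S \<subseteq> {1..n} \<and> n \<in> S}" "T \<in> {S. S \<subseteq> {1..n} \<and> n \<in> S}"
      using h by auto
    then show "y = z" using inj_onD[OF inj_on_cyc_succ] yz by blast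
  qed
  ultimately have "(\<Sum>(\<alpha>, \<beta>)\<in>?B. meander_weight n \<alpha> \<beta>) = (\<Sum>(\<beta>, S)\<in>?A. meander_weight n (cyc_succ S) \<beta>)"
    by (simp only: sum.reindex comp_def case_prod_unfold prod.sel)
  moreover have "fps_nth K_series n = (\<Sum>(\<alpha>, \<beta>)\<in>?B. meander_weight n \<alpha> \<beta>)"
    using assms by (simp add: K_series_def meander_weight_def)
  ultimately have "fps_nth K_series n = (\<Sum>(\<beta>, S)\<in>?A. meander_weight n (cyc_succ S) \<beta>)"
    by (simp only:)
  also have "\<dots> = (\<Sum>\<beta>\<in>NC n. \<Sum>S | S \<subseteq> {1..n} \<and> S \<inter> orbit \<beta> n \<in> {{n}}. meander_weight n (cyc_succ S) \<beta>)"
    by (rule sum.Sigma[symmetric]) (auto intro: finite_subset[of _ "Pow {1..n}"])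
  also have "\<dots> = NC_sum h_seq n"
    unfolding NC_sum_def
  proof (rule sum.cong)
    fix \<beta> assume \<beta>: "\<beta> \<in> NC n"
    have "n \<in> orbit \<beta> n" using mem_orbit_self[OF NC_permutes[OF \<beta>]] .
    then show "(\<Sum>S | S \<subseteq> {1..n} \<and> S \<inter> orbit \<beta> n \<in> {{n}}. meander_weight n (cyc_succ S) \<beta>) =
        h_seq (card (orbit \<beta> n)) * (\<Prod>c\<in>perm_cycles n \<beta> - {orbit \<beta> n}. g_seq (card c))"
      by (subst sum_meander_weight[OF \<beta> n]) (auto simp: h_seq_def)
  qed simp
  finally show ?thesis .
qed

section \<open>Complementing both arguments of the weight\<close>

lemma card_perm_cycles_inv_comp:
  assumes "\<alpha> permutes {1..n}" "\<beta> permutes {1..n}"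
  shows "card (perm_cycles n (\<alpha> \<circ> inv \<beta>)) = card (perm_cycles n (inv \<alpha> \<circ> \<beta>))"
proof -
  have "inv (\<alpha> \<circ> inv \<beta>) = \<alpha> \<circ> (inv \<alpha> \<circ> \<beta>) \<circ> inv \<alpha>"
    using assms by (subst o_inv_distrib)
      (auto simp: permutes_bij bij_imp_bij_inv inv_inv_eq fun_eq_iff permutes_inverses)
  then show ?thesis
    using card_perm_cycles_conj[OF permutes_compose[OF assms(2) permutes_inv[OF assms(1)]] assms(1)]
      perm_cycles_inv[OF permutes_compose[OF permutes_inv[OF assms(2)] assms(1)]] by simp
qed

text \<open>With \<gamma> the full cycle, the inverse complement of \<alpha> times the complement of
  \<beta> is the conjugate by \<gamma> of \<open>\<alpha> \<circ> inv \<beta>\<close>, whose inverse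
  is conjugate to \<open>inv \<alpha> \<circ> \<beta>\<close>. Likewise the inverse complement of
  \<alpha> times \<gamma> is conjugate to \<alpha>. All exponents are invariant under conjugation
  and inversion.\<close>

lemma meander_weight_kreweras:
  assumes "\<alpha> permutes {1..n}" "\<beta> permutes {1..n}"
  shows "meander_weight n (kreweras n \<alpha>) (kreweras n \<beta>) =
    Yv ^ perm_length n (inv \<alpha> \<circ> \<beta>) * Av ^ perm_length n \<alpha> * Bv ^ perm_length n \<beta>"
proof -
  let ?\<gamma> = "full_cycle n"
  have inv_kr: "inv (kreweras n \<sigma>) = inv ?\<gamma> \<circ> \<sigma>" if "\<sigma> permutes {1..n}" for \<sigma>
    unfolding kreweras_def using permutes_bij[OF that] permutes_bij[OF full_cycle_permutes]
    by (subst o_inv_distrib) (simp_all add: bij_imp_bij_inv inv_inv_eq)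
  have conj: "perm_length n (inv ?\<gamma> \<circ> \<sigma> \<circ> ?\<gamma>) = perm_length n \<sigma>" if "\<sigma> permutes {1..n}" for \<sigma>
    using card_perm_cycles_conj[OF that permutes_inv[OF full_cycle_permutes]]
    by (simp add: perm_length_def inv_inv_eq permutes_bij[OF full_cycle_permutes])
  have "inv (kreweras n \<alpha>) \<circ> kreweras n \<beta> = inv ?\<gamma> \<circ> (\<alpha> \<circ> inv \<beta>) \<circ> ?\<gamma>"
    unfolding inv_kr[OF assms(1)] by (simp add: kreweras_def comp_assoc)
  then have "perm_length n (inv (kreweras n \<alpha>) \<circ> kreweras n \<beta>) = perm_length n (\<alpha> \<circ> inv \<beta>)"
    using conj[OF permutes_compose[OF permutes_inv[OF assms(2)] assms(1)]] by simp
  also have "\<dots> = perm_length n (inv \<alpha> \<circ> \<beta>)"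
    by (simp add: perm_length_def card_perm_cycles_inv_comp[OF assms])
  finally have "perm_length n (inv (kreweras n \<alpha>) \<circ> kreweras n \<beta>) = perm_length n (inv \<alpha> \<circ> \<beta>)" .
  then show ?thesis
    by (simp only: meander_weight_def inv_kr[OF assms(1)] inv_kr[OF assms(2)] conj[OF assms(1)] conj[OF assms(2)])
qed

lemma M_series_nth:
  assumes "1 \<le> n"
  shows "fps_nth M_series n = NC_sum (\<lambda>s. (1 + Av * Yv) ^ (s - 1)) n"
proof -
  have n: "n \<in> {1..n}" using assms by simp
  have inj: "inj_on (kreweras n) (Int_part n)"
    using inj_on_kreweras by (rule inj_on_subset) (auto dest: Int_part_permutes)
  have "fps_nth M_series n = (\<Sum>(\<alpha>, \<beta>)\<in>Int_part n \<times> NC n. meander_weight n (kreweras n \<alpha>) (kreweras n \<beta>))"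
    using assms meander_weight_kreweras[OF Int_part_permutes NC_permutes]
    by (auto simp: M_series_def intro!: sum.cong)
  also have "\<dots> = (\<Sum>\<alpha>\<in>Int_part n. \<Sum>\<beta>\<in>NC n. meander_weight n (kreweras n \<alpha>) (kreweras n \<beta>))"
    by (rule sum.cartesian_product[symmetric])
  also have "\<dots> = (\<Sum>\<alpha>\<in>Int_part n. \<Sum>\<beta>\<in>NC n. meander_weight n (kreweras n \<alpha>) \<beta>)"
    \<comment> \<open>For each fixed \<alpha> the complement of \<beta> runs through
      \<open>NC n\<close> exactly once.\<close>
    by (intro sum.cong refl sum.reindex_bij_betw bij_betw_kreweras_NC)
  also have "\<dots> = (\<Sum>\<alpha>\<in>KrInt n. \<Sum>\<beta>\<in>NC n. meander_weight n \<alpha> \<beta>)"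
    by (simp add: KrInt_def sum.reindex[OF inj] comp_def)
  also have "\<dots> = (\<Sum>S | S \<subseteq> {1..n} \<and> n \<in> S. \<Sum>\<beta>\<in>NC n. meander_weight n (cyc_succ S) \<beta>)"
    unfolding KrInt_eq[OF assms] sum.reindex[OF inj_on_cyc_succ] comp_def ..
  also have "\<dots> = (\<Sum>\<beta>\<in>NC n. \<Sum>S | S \<subseteq> {1..n} \<and> n \<in> S. meander_weight n (cyc_succ S) \<beta>)"
    by (rule sum.swap)
  also have "\<dots> = NC_sum (\<lambda>s. (1 + Av * Yv) ^ (s - 1)) n"
    unfolding NC_sum_def
  proof (rule sum.cong)
    fix \<beta> assume \<beta>: "\<beta> \<in> NC n"
    let ?V = "orbit \<beta> n"
    let ?\<T> = "{T \<in> Pow ?V. n \<in> T}"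
    have nV: "n \<in> ?V" using mem_orbit_self[OF NC_permutes[OF \<beta>]] .
    have "finite ?V" using orbit_subset_atLeastAtMost[OF NC_permutes[OF \<beta>] n] finite_subset by blast
    then have finV: "finite (?V - {n})" by simp
    \<comment> \<open>Deleting n from T makes it an arbitrary subset of V - {n} and leaves the
      complement in V unchanged, whence the exponent |V| - 1.\<close>
    have "(\<Sum>T\<in>?\<T>. (Av * Yv) ^ card (?V - T)) = (\<Sum>T\<in>Pow (?V - {n}). (Av * Yv) ^ card (?V - {n} - T))"
      using nV by (intro sum.reindex_bij_witness[where i = "insert n" and j = "\<lambda>T. T - {n}"])
        (auto intro!: arg_cong[where f = card] arg_cong[where f = "\<lambda>k. (Av * Yv) ^ k"])
    also have "\<dots> = (1 + Av * Yv) ^ (card ?V - 1)"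
      using sum_Pow_power_card[OF finV] nV \<open>finite ?V\<close> by simp
    finally have T: "(\<Sum>T\<in>?\<T>. (Av * Yv) ^ card (?V - T)) = (1 + Av * Yv) ^ (card ?V - 1)" .
    have "{S. S \<subseteq> {1..n} \<and> n \<in> S} = {S. S \<subseteq> {1..n} \<and> S \<inter> ?V \<in> ?\<T>}" using nV by blast
    then show "(\<Sum>S | S \<subseteq> {1..n} \<and> n \<in> S. meander_weight n (cyc_succ S) \<beta>) =
        (1 + Av * Yv) ^ (card ?V - 1) * (\<Prod>c\<in>perm_cycles n \<beta> - {?V}. g_seq (card c))"
      using sum_meander_weight[OF \<beta> n, of ?\<T>] by (simp only: T subset_refl)
  qed simp
  finally show ?thesis .
qed

subsection \<open>Removing the last point of a non-crossing partition\<close>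

text \<open>Partitions of arbitrary sets in place of permutations of [n], since the recursion
  produces partitions of intervals that do not start at 1.\<close>

definition nc_partitions :: "nat set \<Rightarrow> nat set set set" where
  "nc_partitions A = {P. partition_on A P \<and> noncrossing P}"

text \<open>A union instead of a definite description, so that the value is {} when no block
  contains x.\<close>

definition block_of :: "nat set set \<Rightarrow> nat \<Rightarrow> nat set" where
  "block_of P x = \<Union>{B \<in> P. x \<in> B}"

lemma block_of_eq: "partition_on A P \<Longrightarrow> B \<in> P \<Longrightarrow> x \<in> B \<Longrightarrow> block_of P x = B"
  unfolding block_of_def using partition_on_unique[of A P B _ x] by blast

lemma ex_block: "partition_on A P \<Longrightarrow> x \<in> A \<Longrightarrow> \<exists>B. B \<in> P \<and> x \<in> B"
  by (auto simp: partition_on_def)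

lemma nc_partitions_empty: "nc_partitions {} = {{}}"
  by (auto simp: nc_partitions_def partition_on_empty noncrossing_def)

lemma sum_NC_eq_sum_nc_partitions:
  "(\<Sum>\<beta>\<in>NC n. F (perm_cycles n \<beta>) \<beta>) = (\<Sum>P\<in>nc_partitions {1..n}. F P (perm_of_partition P))"
proof -
  have "noncrossing_partitions n = nc_partitions {1..n}"
    by (simp add: noncrossing_partitions_def nc_partitions_def)
  then have NC: "NC n = perm_of_partition ` nc_partitions {1..n}" by (simp add: NC_def)
  have inv: "perm_cycles n (perm_of_partition P) = P" if "P \<in> nc_partitions {1..n}" for P
    using that perm_cycles_perm_of_partition unfolding nc_partitions_def by blast
  then have "inj_on perm_of_partition (nc_partitions {1..n})" by (metis inj_onI)
  then show ?thesis unfolding NC by (simp add: sum.reindex inv)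
qed

text \<open>Agrees with \<open>g_hat\<close> and has value 1 at 0 through the empty partition, so
  its series is 1 + G.\<close>

definition nc_sum :: "nat \<Rightarrow> coeff" where
  "nc_sum n = (\<Sum>P\<in>nc_partitions {1..n}. \<Prod>c\<in>P. g_seq (card c))"

definition pointed_nc_sum :: "(nat \<Rightarrow> coeff) \<Rightarrow> nat \<Rightarrow> coeff" where
  "pointed_nc_sum f n = (\<Sum>P\<in>nc_partitions {1..n}. f (card (block_of P n)) *
     (\<Prod>c\<in>P - {block_of P n}. g_seq (card c)))"

lemma g_hat_eq: "g_hat n = nc_sum n"
  unfolding g_hat_def nc_sum_def
  using sum_NC_eq_sum_nc_partitions[of "\<lambda>P _. \<Prod>c\<in>P. g_seq (card c)"] .

lemma one_plus_g_hat_series: "1 + g_hat_series = Abs_fps nc_sum"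
  by (simp add: fps_eq_iff g_hat_series_def g_hat_eq nc_sum_def nc_partitions_empty)

lemma NC_sum_eq_pointed_nc_sum:
  assumes "1 \<le> n"
  shows "NC_sum f n = pointed_nc_sum f n"
proof -
  have "orbit (perm_of_partition P) n = block_of P n" if "P \<in> nc_partitions {1..n}" for P
  proof -
    have P: "partition_on {1..n} P" using that by (simp add: nc_partitions_def)
    then obtain B where "B \<in> P" "n \<in> B" using ex_block[OF P, of n] assms by auto
    then show ?thesis using orbit_perm_of_partition[OF P] block_of_eq[OF P] by simp
  qed
  then show ?thesis
    unfolding NC_sum_def pointed_nc_sum_def
    using sum_NC_eq_sum_nc_partitions[of "\<lambda>P \<beta>. f (card (orbit \<beta> n)) * (\<Prod>c\<in>P - {orbit \<beta> n}. g_seq (card c))" n]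
    by simp
qed

section \<open>Transport along order-reflecting maps\<close>

lemma noncrossing_image:
  assumes "noncrossing P" "\<And>x y. x \<in> \<Union>P \<Longrightarrow> y \<in> \<Union>P \<Longrightarrow> f x < f y \<Longrightarrow> x < y"
  shows "noncrossing ((`) f ` P)"
  unfolding noncrossing_def
proof (intro notI, elim bexE conjE imageE)
  fix B C a b c d B' C' a' b' c' d'
  assume h: "B' \<in> P" "C' \<in> P" "B = f ` B'" "C = f ` C'" "a \<in> B" "b \<in> B" "c \<in> C" "d \<in> C"
    "B \<noteq> C" "a < c" "c < b" "b < d"
  then obtain a' b' c' d' where "a' \<in> B'" "b' \<in> B'" "c' \<in> C'" "d' \<in> C'"
    "a = f a'" "b = f b'" "c = f c'" "d = f d'" by blast
  then have "B' = C'"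
    using h assms(2) by (intro noncrossing_same[OF assms(1), of B' C' a' b' c' d']) auto
  then show False using h by simp
qed

lemma nc_partitions_shift:
  assumes "P \<in> nc_partitions A" "inj_on f A" "\<And>x y. x \<in> A \<Longrightarrow> y \<in> A \<Longrightarrow> f x < f y \<Longrightarrow> x < y"
  shows "(`) f ` P \<in> nc_partitions (f ` A)"
proof -
  have P: "partition_on A P" "noncrossing P" using assms(1) by (auto simp: nc_partitions_def)
  have "{} \<notin> (`) f ` P" using P(1) by (auto simp: partition_on_def)
  then have "partition_on (f ` A) ((`) f ` P)"
    using partition_on_inj_image[OF P(1) assms(2)] by simp
  moreover have "noncrossing ((`) f ` P)"
    using P assms(3) by (intro noncrossing_image) (auto dest: partition_onD1)
  ultimately show ?thesis by (simp add: nc_partitions_def)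
qed

lemma sum_nc_partitions_shift:
  "(\<Sum>P\<in>nc_partitions {Suc k..k + m}. \<Prod>c\<in>P. g_seq (card c)) = nc_sum m"
proof -
  let ?f = "\<lambda>x::nat. x + k" and ?g = "\<lambda>x::nat. x - k"
  have img: "?f ` {1..m} = {Suc k..k + m}"
    unfolding image_add_atLeastAtMost' by (simp add: add.commute)
  have img': "?g ` {Suc k..k + m} = {1..m}"
    unfolding img[symmetric] image_image by simp
  note img = img img'
  have fg: "(`) ?f ` (`) ?g ` P = P" if "P \<in> nc_partitions {Suc k..k + m}" for P
  proof -
    have "?f ` ?g ` B = B" if B: "B \<in> P" for B
    proof -
      have "B \<subseteq> {Suc k..k + m}"
        using \<open>P \<in> _\<close> B by (auto simp: nc_partitions_def partition_on_def)
      then have "\<And>x. x \<in> B \<Longrightarrow> x - k + k = x" by auto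
      then show ?thesis by (simp add: image_image)
    qed
    then show ?thesis by (simp add: image_image)
  qed
  \<comment> \<open>Adding k and then subtracting it is the identity on all naturals; the opposite
    order relied on the points being at least k.\<close>
  have gf: "(`) ?g ` (`) ?f ` P = P" for P :: "nat set set" by (simp add: image_image)
  show ?thesis unfolding nc_sum_def
  proof (rule sum.reindex_bij_witness[where i = "image ((`) ?f)" and j = "image ((`) ?g)"])
    fix P assume P: "P \<in> nc_partitions {Suc k..k + m}"
    show "(`) ?f ` (`) ?g ` P = P" by (rule fg[OF P])
    have inj: "inj_on ?g {Suc k..k + m}" by (rule inj_onI) auto
    have "(`) ?g ` P \<in> nc_partitions (?g ` {Suc k..k + m})"
      by (rule nc_partitions_shift[OF P inj]) linarith
    then show "(`) ?g ` P \<in> nc_partitions {1..m}" by (simp only: img)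
    have sub: "B \<subseteq> {Suc k..k + m}" if "B \<in> P" for B
      using P that by (auto simp: nc_partitions_def partition_on_def)
    have "card (?g ` B) = card B" if "B \<in> P" for B
      using card_image[OF inj_on_subset[OF inj sub[OF that]]] .
    moreover have "inj_on ((`) ?g) P"
      by (rule inj_onI) (use inj_on_image_eq_iff[OF inj sub sub] in blast)
    ultimately show "(\<Prod>c\<in>(`) ?g ` P. g_seq (card c)) = (\<Prod>c\<in>P. g_seq (card c))"
      by (simp add: prod.reindex)
  next
    fix P assume P: "P \<in> nc_partitions {1..m}"
    show "(`) ?g ` (`) ?f ` P = P" by (rule gf)
    have "(`) ?f ` P \<in> nc_partitions (?f ` {1..m})"
      by (rule nc_partitions_shift[OF P]) simp_all
    then show "(`) ?f ` P \<in> nc_partitions {Suc k..k + m}" by (simp only: img)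
  qed
qed

text \<open>Here \<open>k\<close> is the predecessor of \<open>n\<close> in its block, and \<open>k = 0\<close> if the block is \<open>{n}\<close>;
  then \<open>P = {}\<close> and \<open>block_of P 0 = {}\<close>.\<close>

definition join_nc :: "nat \<Rightarrow> nat \<times> nat set set \<times> nat set set \<Rightarrow> nat set set" where
  "join_nc n = (\<lambda>(k, P, Q). insert (insert n (block_of P k)) ((P - {block_of P k}) \<union> Q))"

text \<open>Intended inverse of \<open>join_nc\<close>. The inserted 0 gives k = 0 when n is alone
  in its block; U is then empty and is discarded by removing \<open>{}\<close>.\<close>

definition split_nc :: "nat \<Rightarrow> nat set set \<Rightarrow> nat \<times> nat set set \<times> nat set set" where
  "split_nc n P = (let V = block_of P n; U = V - {n}; k = Max (insert 0 U) in
     (k, insert U {B \<in> P - {V}. B \<subseteq> {1..k}} - {{}}, {B \<in> P - {V}. B \<subseteq> {Suc k..<n}}))"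

text \<open>If k > 0, it is the maximum of W, so attaching n + 1 to W crosses no block of P, while
  the blocks of Q lie strictly between k and n + 1.\<close>

lemma join_nc_props:
  assumes k: "k \<le> n" and P: "P \<in> nc_partitions {1..k}" and Q: "Q \<in> nc_partitions {Suc k..n}"
  defines "W \<equiv> block_of P k" and "J \<equiv> join_nc (Suc n) (k, P, Q)"
  shows "J \<in> nc_partitions {1..Suc n}" and "block_of J (Suc n) = insert (Suc n) W"
    and "J - {insert (Suc n) W} = (P - {W}) \<union> Q" and "(P - {W}) \<inter> Q = {}"
    and "split_nc (Suc n) J = (k, P, Q)" and "W \<subseteq> {1..k}"
proof -
  have part: "partition_on {1..k} P" "partition_on {Suc k..n} Q" and nc: "noncrossing P" "noncrossing Q"
    using P Q by (auto simp: nc_partitions_def)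
  let ?V = "insert (Suc n) W"
  have W: "(k = 0 \<and> P = {} \<and> W = {}) \<or> (1 \<le> k \<and> W \<in> P \<and> k \<in> W)"
  proof (cases "k = 0")
    case True
    then show ?thesis using part(1) by (auto simp: partition_on_empty W_def block_of_def)
  next
    case False
    then obtain B where "B \<in> P" "k \<in> B" using ex_block[OF part(1), of k] by auto
    then show ?thesis using block_of_eq[OF part(1)] False by (auto simp: W_def)
  qed
  have subP: "B \<subseteq> {1..k}" if "B \<in> P" for B using that part(1) by (auto simp: partition_on_def)
  have subQ: "B \<subseteq> {Suc k..n}" if "B \<in> Q" for B using that part(2) by (auto simp: partition_on_def)
  have neP: "B \<noteq> {}" if "B \<in> P" for B using that part(1) by (auto simp: partition_on_def)
  have neQ: "B \<noteq> {}" if "B \<in> Q" for B using that part(2) by (auto simp: partition_on_def)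
  show Wk: "W \<subseteq> {1..k}" using W subP by blast
  have J: "J = insert ?V ((P - {W}) \<union> Q)" by (simp add: J_def join_nc_def W_def)
  have "Suc n \<notin> {1..k}" "Suc n \<notin> {Suc k..n}" using k by simp_all
  then have N: "Suc n \<notin> B" if "B \<in> (P - {W}) \<union> Q" for B
    using that subP[of B] subQ[of B] by blast
  have disjPQ: "B \<inter> C = {}" if "B \<subseteq> {1..k}" "C \<in> Q" for B C
    using that subQ[of C] by fastforce
  show "(P - {W}) \<inter> Q = {}"
  proof (intro equals0I, elim IntE)
    fix B assume "B \<in> P - {W}" "B \<in> Q"
    then show False using disjPQ[of B B] subP neP by blast
  qed
  show JV: "J - {?V} = (P - {W}) \<union> Q" unfolding J using N by blast
  have disjV: "?V \<inter> B = {}" if "B \<in> (P - {W}) \<union> Q" for B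
  proof -
    have "W \<inter> B = {}"
      using that
    proof
      assume "B \<in> Q" then show ?thesis using disjPQ[OF Wk] by simp
    next
      assume "B \<in> P - {W}"
      then show ?thesis using W partition_on_unique[OF part(1), of B W] by blast
    qed
    then show ?thesis using N[OF that] by blast
  qed
  have "partition_on {1..Suc n} J"
  proof (rule partition_onI)
    have "\<Union>J = insert (Suc n) (\<Union>P \<union> \<Union>Q)" unfolding J using W by auto
    also have "\<dots> = {1..Suc n}"
      using k unfolding partition_onD1[OF part(1), symmetric] partition_onD1[OF part(2), symmetric] by auto
    finally show "\<Union>J = {1..Suc n}" .
    show "{} \<notin> J" unfolding J using neP neQ by blast
    fix B C assume BC: "B \<in> J" "C \<in> J" "B \<noteq> C"
    have PP: "B \<inter> C = {}" if "B \<in> P" "C \<in> P"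
      using partition_on_unique[OF part(1) that] BC(3) by blast
    have QQ: "B \<inter> C = {}" if "B \<in> Q" "C \<in> Q"
      using partition_on_unique[OF part(2) that] BC(3) by blast
    have PQ: "B \<inter> C = {}" if "B \<in> P" "C \<in> Q" using disjPQ[OF subP] that by simp
    have QP: "B \<inter> C = {}" if "B \<in> Q" "C \<in> P" using disjPQ[OF subP, of C B] that by blast
    consider "B = ?V" "C \<in> (P - {W}) \<union> Q" | "C = ?V" "B \<in> (P - {W}) \<union> Q"
      | "B \<in> (P - {W}) \<union> Q" "C \<in> (P - {W}) \<union> Q"
      using BC unfolding J by blast
    then show "disjnt B C"
    proof cases
      case 1 then show ?thesis using disjV[of C] by (simp add: disjnt_def)
    next
      case 2 then show ?thesis using disjV[of B] by (simp add: disjnt_def Int_commute)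
    next
      case 3 then show ?thesis unfolding disjnt_def using PP QQ PQ QP by blast
    qed
  qed
  note partJ = this
  have "noncrossing J"
    unfolding noncrossing_def
  proof (intro notI, elim bexE conjE)
    fix B C a b c d
    assume BC: "B \<in> J" "C \<in> J" "B \<noteq> C"
      and mem: "a \<in> B" "b \<in> B" "c \<in> C" "d \<in> C" and less: "a < c" "c < b" "b < d"
    have ranges: "x \<in> {1..k}" if "x \<in> D" "D \<in> P" for x D using that subP by blast
    have rangesQ: "x \<in> {Suc k..n}" if "x \<in> D" "D \<in> Q" for x D using that subQ by blast
    have rangesV: "x = Suc n \<or> x \<in> W \<and> x \<in> {1..k}" if "x \<in> ?V" for x using that Wk by blast
    have crossP: False if "D \<in> P" "E \<in> P" "D \<noteq> E" "x \<in> D" "y \<in> D" "u \<in> E" "v \<in> E" "x < u" "u < y" "y < v"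
      for D E x y u v using noncrossing_same[OF nc(1) that(1,2,4-10)] that(3) by simp
    have crossQ: False if "D \<in> Q" "E \<in> Q" "D \<noteq> E" "x \<in> D" "y \<in> D" "u \<in> E" "v \<in> E" "x < u" "u < y" "y < v"
      for D E x y u v using noncrossing_same[OF nc(2) that(1,2,4-10)] that(3) by simp
    have kind: "D = ?V \<or> D \<in> P \<and> D \<noteq> W \<or> D \<in> Q" if "D \<in> J" for D
      using that unfolding J by blast
    consider "B = ?V" "C \<in> P" "C \<noteq> W" | "B = ?V" "C \<in> Q" | "B \<in> P" "B \<noteq> W" "C = ?V" | "B \<in> Q" "C = ?V"
      | "B \<in> P" "C \<in> P" | "B \<in> P" "C \<in> Q" | "B \<in> Q" "C \<in> P" | "B \<in> Q" "C \<in> Q"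
      using kind[OF BC(1)] kind[OF BC(2)] BC(3) by metis
    then show False
    proof cases
      case 1
      have d: "d \<le> k" using ranges[OF mem(4) 1(2)] by simp
      then have ab: "a \<in> W" "b \<in> W"
        using rangesV[OF mem(1)[unfolded 1(1)]] rangesV[OF mem(2)[unfolded 1(1)]] less k by linarith+
      then have "W \<in> P" using W by blast
      then show False using crossP[OF _ 1(2) _ ab mem(3,4) less] 1(3) by metis
    next
      case 2
      then show False
        using rangesV[OF mem(2)[unfolded 2(1)]] rangesQ[OF mem(3) 2(2)] rangesQ[OF mem(4) 2(2)] less by auto
    next
      case 3
      have b: "b \<le> k" "1 \<le> b" using ranges[OF mem(2) 3(1)] by simp_all
      then have WP: "W \<in> P" "k \<in> W" using W by auto
      have c: "c \<in> W" using rangesV[OF mem(3)[unfolded 3(3)]] less b k by linarith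
      \<comment> \<open>The point d may be the new point n + 1, which P does not know; k \<in> W
        replaces it, for which k must lie strictly above b.\<close>
      have "b \<noteq> k" using partition_on_unique[OF part(1) 3(1) WP(1)] mem(2) WP(2) 3(2) by blast
      then have "b < k" using b by simp
      then show False using crossP[OF 3(1) WP(1) 3(2) mem(1,2) c WP(2) less(1,2)] by metis
    next
      case 4
      then show False
        using rangesV[OF mem(3)[unfolded 4(2)]] rangesQ[OF mem(1) 4(1)] rangesQ[OF mem(2) 4(1)] less by auto
    next
      case 5 then show False using crossP[OF _ _ BC(3) mem less] by metis
    next
      case 6 then show False using ranges[OF mem(2)] rangesQ[OF mem(3)] less by simp
    next
      case 7 then show False using ranges[OF mem(3)] rangesQ[OF mem(1)] less by simp
    next
      case 8 then show False using crossQ[OF _ _ BC(3) mem less] by metis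
    qed
  qed
  then show "J \<in> nc_partitions {1..Suc n}" using partJ by (simp add: nc_partitions_def)
  show blk: "block_of J (Suc n) = ?V" using J by (intro block_of_eq[OF partJ]) auto
  have VN: "?V - {Suc n} = W" using Wk k by auto
  have "Max (insert 0 W) = k"
    using W Wk finite_subset[OF Wk] by (intro Max_eqI) auto
  moreover have "{B \<in> (P - {W}) \<union> Q. B \<subseteq> {1..k}} = P - {W}"
  proof -
    have "\<not> B \<subseteq> {1..k}" if "B \<in> Q" for B using disjPQ[of B B] that neQ by blast
    then show ?thesis using subP by blast
  qed
  moreover have "insert W (P - {W}) - {{}} = P" using W neP by auto
  moreover have "{B \<in> (P - {W}) \<union> Q. B \<subseteq> {Suc k..<Suc n}} = Q"
  proof -
    have "\<not> B \<subseteq> {Suc k..<Suc n}" if "B \<in> P" for B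
      using subP[OF that] neP[OF that] by fastforce
    then show ?thesis using subQ by (auto simp: atLeastLessThanSuc_atLeastAtMost)
  qed
  ultimately show "split_nc (Suc n) J = (k, P, Q)"
    by (simp only: split_nc_def Let_def blk JV VN)
qed

lemma split_nc_props:
  assumes "P \<in> nc_partitions {1..Suc n}"
  shows "split_nc (Suc n) P \<in> (SIGMA k:{..n}. nc_partitions {1..k} \<times> nc_partitions {Suc k..n})"
    and "join_nc (Suc n) (split_nc (Suc n) P) = P"
proof -
  have part: "partition_on {1..Suc n} P" and nc: "noncrossing P"
    using assms by (auto simp: nc_partitions_def)
  obtain V where V: "V \<in> P" "Suc n \<in> V" using ex_block[OF part, of "Suc n"] by auto
  have blk: "block_of P (Suc n) = V" using block_of_eq[OF part V] .
  have sub: "B \<subseteq> {1..Suc n}" if "B \<in> P" for B using that part by (auto simp: partition_on_def)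
  have ne: "B \<noteq> {}" if "B \<in> P" for B using that part by (auto simp: partition_on_def)
  have fin: "finite B" if "B \<in> P" for B using partition_on_finite_block[OF part _ that] by simp
  define U where "U = V - {Suc n}"
  define k where "k = Max (insert 0 U)"
  have finU: "finite U" using fin[OF V(1)] by (simp add: U_def)
  have U: "U \<subseteq> {1..n}" using sub[OF V(1)] by (auto simp: U_def)
  have kU: "k = 0 \<and> U = {} \<or> 1 \<le> k \<and> k \<in> U"
  proof (cases "U = {}")
    case False
    then have "k \<in> U" unfolding k_def using finU U Max_in[of "insert 0 U"] Max_ge[of "insert 0 U"]
      by (metis Max_in Max_insert finite.insertI max_0L)
    then show ?thesis using U by auto
  qed (simp add: k_def)
  have Uk: "U \<subseteq> {1..k}" using U finU by (auto simp: k_def)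
  have kn: "k \<le> n" using kU U by auto
  let ?P1 = "{B \<in> P - {V}. B \<subseteq> {1..k}}" and ?P2 = "{B \<in> P - {V}. B \<subseteq> {Suc k..n}}"
  have disjV: "B \<inter> V = {}" if "B \<in> P - {V}" for B
    using partition_on_unique[OF part _ V(1)] that by blast
  \<comment> \<open>A block with points y < k < x on both sides of k would cross V, which contains k
    and n + 1.\<close>
  have dich: "B \<in> ?P1 \<or> B \<in> ?P2" if B: "B \<in> P - {V}" for B
  proof (rule ccontr)
    assume "\<not> (B \<in> ?P1 \<or> B \<in> ?P2)"
    then have nsub: "\<not> B \<subseteq> {1..k}" "\<not> B \<subseteq> {Suc k..n}" using B by simp_all
    have "Suc n \<notin> B" using disjV[OF B] V(2) by blast
    moreover have "B \<subseteq> {1..Suc n}" using sub B by simp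
    moreover have "{1..Suc n} - {Suc n} = {1..n}" by auto
    ultimately have Bn: "B \<subseteq> {1..n}" by blast
    obtain x where "x \<in> B" "x \<notin> {1..k}" using nsub(1) by blast
    moreover obtain y where "y \<in> B" "y \<notin> {Suc k..n}" using nsub(2) by blast
    moreover from calculation have "x \<in> {1..n}" "y \<in> {1..n}" using Bn by blast+
    ultimately have xy: "x \<in> B" "k < x" "y \<in> B" "y \<le> k" "1 \<le> y" "x \<le> n"
      by auto
    then have "k \<in> V" using kU by (auto simp: U_def)
    then have "y \<noteq> k" using disjV[OF B] xy by blast
    then have "B = V"
      using xy B V \<open>k \<in> V\<close> by (intro noncrossing_same[OF nc, of B V y x k "Suc n"]) auto
    then show False using B by simp
  qed
  have P_eq: "P = insert V (?P1 \<union> ?P2)" using V dich by blast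
  have split: "split_nc (Suc n) P = (k, insert U ?P1 - {{}}, ?P2)"
    by (simp only: split_nc_def Let_def blk U_def[symmetric] k_def[symmetric] atLeastLessThanSuc_atLeastAtMost)
  have P1: "insert U ?P1 - {{}} \<in> nc_partitions {1..k}"
    unfolding nc_partitions_def
  proof (intro CollectI conjI partition_onI)
    have "x \<in> \<Union>(insert U ?P1)" if x: "x \<in> {1..k}" for x
    proof -
      obtain B where B: "B \<in> P" "x \<in> B" using x kn ex_block[OF part, of x] by auto
      show ?thesis
      proof (cases "B = V")
        case True then show ?thesis using B x kn by (auto simp: U_def)
      next
        case False
        then have "B \<in> ?P1" using dich[of B] B x by auto
        then show ?thesis using B by blast
      qed
    qed
    then have "\<Union>(insert U ?P1) = {1..k}" using Uk by blast
    then show "\<Union>(insert U ?P1 - {{}}) = {1..k}" by auto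
    show "{} \<notin> insert U ?P1 - {{}}" by simp
    fix B C assume BC: "B \<in> insert U ?P1 - {{}}" "C \<in> insert U ?P1 - {{}}" "B \<noteq> C"
    have "U \<inter> D = {}" if "D \<in> ?P1" for D using disjV[of D] that by (auto simp: U_def)
    moreover have "B \<inter> C = {}" if "B \<in> ?P1" "C \<in> ?P1"
      using partition_on_unique[OF part, of B C] that BC(3) by blast
    ultimately show "disjnt B C" using BC unfolding disjnt_def by blast
  next
    show "noncrossing (insert U ?P1 - {{}})"
      unfolding noncrossing_def
    proof (intro notI, elim bexE conjE)
      fix B C a b c d
      assume BC: "B \<in> insert U ?P1 - {{}}" "C \<in> insert U ?P1 - {{}}" "B \<noteq> C"
        and mem: "a \<in> B" "b \<in> B" "c \<in> C" "d \<in> C" and less: "a < c" "c < b" "b < d"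
      \<comment> \<open>U is only a piece of a block of P, so it is replaced by V; V is not among
        the other blocks, hence distinct blocks stay distinct.\<close>
      define ext where "ext D = (if D = U then V else D)" for D
      have ext: "ext D \<in> P" "D \<subseteq> ext D" if "D \<in> insert U ?P1" for D
        using that V(1) by (auto simp: ext_def U_def)
      have "ext B = ext C"
        using ext[of B] ext[of C] BC mem less by (intro noncrossing_same[OF nc, of _ _ a b c d]) auto
      then show False using BC by (auto simp: ext_def split: if_splits)
    qed
  qed
  have P2: "?P2 \<in> nc_partitions {Suc k..n}"
    unfolding nc_partitions_def
  proof (intro CollectI conjI partition_onI)
    have "x \<in> \<Union>?P2" if x: "x \<in> {Suc k..n}" for x
    proof -
      obtain B where B: "B \<in> P" "x \<in> B" using x ex_block[OF part, of x] by auto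
      have "B \<noteq> V" using B x Uk by (auto simp: U_def)
      then have "B \<in> ?P2" using dich[of B] B x by auto
      then show ?thesis using B by blast
    qed
    then show "\<Union>?P2 = {Suc k..n}" by blast
    show "{} \<notin> ?P2" using ne by blast
    fix B C assume BC: "B \<in> ?P2" "C \<in> ?P2" "B \<noteq> C"
    then show "disjnt B C" using partition_on_unique[OF part, of B C] unfolding disjnt_def by blast
  next
    show "noncrossing ?P2"
      using nc unfolding noncrossing_def by (metis (no_types, lifting) DiffD1 mem_Collect_eq)
  qed
  show "split_nc (Suc n) P \<in> (SIGMA k:{..n}. nc_partitions {1..k} \<times> nc_partitions {Suc k..n})"
    unfolding split using P1 P2 kn by blast
  have "block_of (insert U ?P1 - {{}}) k = U"
  proof (cases "k = 0")
    case True
    then show ?thesis using kU by (auto simp: block_of_def)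
  next
    case False
    then show ?thesis
      using kU P1 by (intro block_of_eq[of "{1..k}"]) (auto simp: nc_partitions_def)
  qed
  moreover have "insert (Suc n) U = V" using V by (auto simp: U_def)
  moreover have "(insert U ?P1 - {{}}) - {U} = ?P1"
  proof -
    have "D \<noteq> U" if "D \<in> ?P1" for D
      using disjV[of D] that ne[of D] by (auto simp: U_def)
    then show ?thesis using ne by blast
  qed
  ultimately show "join_nc (Suc n) (split_nc (Suc n) P) = P"
    unfolding split join_nc_def by (simp only: prod.case flip: P_eq)
qed

lemma finite_nc_partitions: "finite A \<Longrightarrow> finite (nc_partitions A)"
  using finitely_many_partition_on[of A] by (auto simp: nc_partitions_def intro: finite_subset)

lemma pointed_nc_sum_0: "pointed_nc_sum f 0 = f 0"
  by (simp add: pointed_nc_sum_def nc_partitions_empty block_of_def)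

text \<open>Only the last gap is cut off: {k+1..n} contributes \<open>nc_sum (n - k)\<close>, and
  the rest is the same problem at k with a block smaller by one, hence the shift of f. Iteration
  disposes of all gaps.\<close>

lemma pointed_nc_sum_Suc:
  "pointed_nc_sum f (Suc n) = (\<Sum>k\<le>n. pointed_nc_sum (\<lambda>s. f (Suc s)) k * nc_sum (n - k))"
proof -
  let ?T = "SIGMA k:{..n}. nc_partitions {1..k} \<times> nc_partitions {Suc k..n}"
  let ?w = "\<lambda>k P. f (Suc (card (block_of P k))) * (\<Prod>c\<in>P - {block_of P k}. g_seq (card c))"
  let ?g = "\<lambda>Q. \<Prod>c\<in>Q. g_seq (card c)"
  have "pointed_nc_sum f (Suc n) = (\<Sum>(k, P, Q)\<in>?T. ?w k P * ?g Q)"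
    unfolding pointed_nc_sum_def
  proof (rule sum.reindex_bij_witness[symmetric, where i = "split_nc (Suc n)" and j = "join_nc (Suc n)"])
    fix z assume "z \<in> ?T"
    then obtain k P Q where z: "z = (k, P, Q)" "k \<le> n" "P \<in> nc_partitions {1..k}" "Q \<in> nc_partitions {Suc k..n}"
      by auto
    note J = join_nc_props[OF z(2-4)]
    let ?J = "join_nc (Suc n) (k, P, Q)" and ?W = "block_of P k"
    show "split_nc (Suc n) (join_nc (Suc n) z) = z" using J(5) z(1) by simp
    show "join_nc (Suc n) z \<in> nc_partitions {1..Suc n}" using J(1) z(1) by simp
    have fin: "finite P" "finite Q"
      using z(3,4) finite_elements[of _ P] finite_elements[of _ Q] by (auto simp: nc_partitions_def)
    have "Suc n \<notin> ?W" using J(6) z(2) by auto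
    then have "card (block_of ?J (Suc n)) = Suc (card ?W)"
      using finite_subset[OF J(6)] by (simp add: J(2))
    moreover have "(\<Prod>c\<in>?J - {block_of ?J (Suc n)}. g_seq (card c)) =
        (\<Prod>c\<in>P - {?W}. g_seq (card c)) * ?g Q"
      unfolding J(2) J(3) using fin J(4) by (intro prod.union_disjoint) auto
    ultimately show "f (card (block_of (join_nc (Suc n) z) (Suc n))) *
        (\<Prod>c\<in>join_nc (Suc n) z - {block_of (join_nc (Suc n) z) (Suc n)}. g_seq (card c)) =
        (case z of (k, P, Q) \<Rightarrow> ?w k P * ?g Q)"
      by (simp add: z(1) mult.assoc)
  next
    fix P assume "P \<in> nc_partitions {1..Suc n}"
    then show "join_nc (Suc n) (split_nc (Suc n) P) = P" "split_nc (Suc n) P \<in> ?T"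
      by (rule split_nc_props(2), rule split_nc_props(1))
  qed
  also have "\<dots> = (\<Sum>k\<le>n. \<Sum>(P, Q)\<in>nc_partitions {1..k} \<times> nc_partitions {Suc k..n}. ?w k P * ?g Q)"
    by (rule sum.Sigma[symmetric]) (auto intro!: finite_nc_partitions)
  also have "\<dots> = (\<Sum>k\<le>n. pointed_nc_sum (\<lambda>s. f (Suc s)) k * nc_sum (n - k))"
  proof (rule sum.cong)
    fix k assume "k \<in> {..n}"
    then have "(\<Sum>Q\<in>nc_partitions {Suc k..n}. ?g Q) = nc_sum (n - k)"
      using sum_nc_partitions_shift[of k "n - k"] by simp
    then show "(\<Sum>(P, Q)\<in>nc_partitions {1..k} \<times> nc_partitions {Suc k..n}. ?w k P * ?g Q) =
        pointed_nc_sum (\<lambda>s. f (Suc s)) k * nc_sum (n - k)"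
      by (simp add: pointed_nc_sum_def sum_product sum.cartesian_product flip: \<open>_ = nc_sum (n - k)\<close>)
  qed simp
  finally show ?thesis .
qed

subsection \<open>Generating functions\<close>

definition pointed_nc_series :: "(nat \<Rightarrow> coeff) \<Rightarrow> coeff fps" where
  "pointed_nc_series f = Abs_fps (pointed_nc_sum f)"

lemma pointed_nc_series_rec:
  "pointed_nc_series f = fps_const (f 0) +
    fps_X * (1 + g_hat_series) * pointed_nc_series (\<lambda>s. f (Suc s))"
proof (rule fps_ext)
  fix n
  let ?E = "pointed_nc_series (\<lambda>s. f (Suc s))"
  have "fps_X * (1 + g_hat_series) * ?E = fps_X * (?E * Abs_fps nc_sum)"
    by (simp only: one_plus_g_hat_series mult_ac)
  moreover have "fps_nth (pointed_nc_series f) n = fps_nth (fps_const (f 0) + fps_X * (?E * Abs_fps nc_sum)) n"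
  proof (cases n)
    case 0
    then show ?thesis by (simp add: pointed_nc_series_def pointed_nc_sum_0)
  next
    case (Suc m)
    have "fps_nth (fps_X * (?E * Abs_fps nc_sum)) n = fps_nth (?E * Abs_fps nc_sum) m"
      by (simp add: Suc)
    then show ?thesis
      by (simp add: Suc pointed_nc_series_def pointed_nc_sum_Suc fps_mult_nth atMost_atLeast0)
  qed
  ultimately show "fps_nth (pointed_nc_series f) n =
      fps_nth (fps_const (f 0) + fps_X * (1 + g_hat_series) * ?E) n"
    by (simp only:)
qed

text \<open>For powers of q the shift of f is multiplication by q, so the recursion closes up to a
  linear equation for a single series.\<close>

lemma pointed_nc_series_power:
  "(1 - fps_const q * (fps_X * (1 + g_hat_series))) * pointed_nc_series (\<lambda>s. q ^ s) = 1"
proof -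
  have "pointed_nc_series (\<lambda>s. q ^ Suc s) = fps_const q * pointed_nc_series (\<lambda>s. q ^ s)"
    by (simp add: fps_eq_iff pointed_nc_series_def pointed_nc_sum_def sum_distrib_left mult.assoc)
  then have "pointed_nc_series (\<lambda>s. q ^ s) = 1 +
      fps_X * (1 + g_hat_series) * (fps_const q * pointed_nc_series (\<lambda>s. q ^ s))"
    using pointed_nc_series_rec[of "\<lambda>s. q ^ s"] by (simp del: power_Suc)
  moreover have "(1 - c * u) * E = 1" if "E = 1 + u * (c * E)" for c u E :: "coeff fps"
  proof -
    have "(1 - c * u) * E = E - u * (c * E)" by (simp add: algebra_simps)
    also have "\<dots> = 1" using that by (metis add_diff_cancel_right')
    finally show ?thesis .
  qed
  ultimately show ?thesis by blast
qed

text \<open>One recursion step reduces the exponent s - 1 to s. It is used with q = AY for K and q =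
  1 + AY for M.\<close>

lemma shifted_power_series:
  assumes "fps_nth F 0 = 0" "\<And>n. 1 \<le> n \<Longrightarrow> fps_nth F n = pointed_nc_sum (\<lambda>s. q ^ (s - 1)) n"
  defines "u \<equiv> fps_X * (1 + g_hat_series)"
  shows "F * (1 - fps_const q * u) = u"
proof -
  \<comment> \<open>Truncated subtraction gives weight 1 at s = 0; this is the constant term by
    which the series exceeds F.\<close>
  have "pointed_nc_series (\<lambda>s. q ^ (s - 1)) = 1 + u * pointed_nc_series (\<lambda>s. q ^ s)"
    using pointed_nc_series_rec[of "\<lambda>s. q ^ (s - 1)"] by (simp add: u_def)
  moreover have "pointed_nc_series (\<lambda>s. q ^ (s - 1)) = 1 + F"
  proof (rule fps_ext)
    fix n show "fps_nth (pointed_nc_series (\<lambda>s. q ^ (s - 1))) n = fps_nth (1 + F) n"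
      using assms(1,2) by (cases "n = 0") (simp_all add: pointed_nc_series_def pointed_nc_sum_0)
  qed
  ultimately have F: "F = u * pointed_nc_series (\<lambda>s. q ^ s)" by simp
  show ?thesis
    using arg_cong[OF pointed_nc_series_power[of q], of "\<lambda>E. u * E"]
    unfolding F u_def[symmetric] by (simp add: mult_ac)
qed

text \<open>h is the geometric series X / (1 - AY X), composed with u. The equation without division
  matches the one satisfied by K, so that the common factor can be cancelled.\<close>

lemma h_series_compose:
  assumes "fps_nth u 0 = 0"
  shows "(h_series oo u) * (1 - fps_const (Av * Yv) * u) = u"
proof -
  have "h_series * (1 - fps_const (Av * Yv) * fps_X) = fps_X"
  proof (rule fps_ext)
    fix n
    have "fps_nth (h_series * (fps_const (Av * Yv) * fps_X)) n =
        (if n = 0 then 0 else Av * Yv * fps_nth h_series (n - 1))"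
      by (simp add: mult.left_commute[of h_series])
    then show "fps_nth (h_series * (1 - fps_const (Av * Yv) * fps_X)) n = fps_nth fps_X n"
      by (cases n; cases "n - 1") (simp_all add: right_diff_distrib h_series_def h_seq_def)
  qed
  then have "(h_series * (1 - fps_const (Av * Yv) * fps_X)) oo u = u"
    using assms by simp
  then show ?thesis
    using assms by (simp add: fps_compose_mult_distrib fps_compose_sub_distrib)
qed

text \<open>u^s has no terms below degree s, so the n-th coefficient of the partial sums is constant
  from N = n on, which is convergence of formal power series.\<close>

lemma fps_compose_sums:
  fixes a u :: "'a::comm_ring_1 fps"
  assumes "fps_nth u 0 = 0" "fps_nth a 0 = 0"
  shows "(\<lambda>s. fps_const (fps_nth a (Suc s)) * u ^ Suc s) sums (a oo u)"
  unfolding sums_def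
proof (rule tendsto_fpsI)
  fix n
  show "\<forall>\<^sub>F N in sequentially. fps_nth (\<Sum>s<N. fps_const (fps_nth a (Suc s)) * u ^ Suc s) n = fps_nth (a oo u) n"
    unfolding eventually_sequentially
  proof (intro exI allI impI)
    fix N assume "n \<le> N"
    have "fps_nth (\<Sum>s<N. fps_const (fps_nth a (Suc s)) * u ^ Suc s) n =
        (\<Sum>s<N. fps_nth a (Suc s) * fps_nth (u ^ Suc s) n)"
      by (simp add: fps_sum_nth del: power_Suc)
    also have "\<dots> = (\<Sum>i\<le>N. fps_nth a i * fps_nth (u ^ i) n)"
      using assms(2) by (simp add: lessThan_Suc_atMost[symmetric] sum.lessThan_Suc_shift del: power_Suc sum.lessThan_Suc)
    also have "\<dots> = (\<Sum>i=0..n. fps_nth a i * fps_nth (u ^ i) n)"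
      using \<open>n \<le> N\<close> startsby_zero_power_prefix[OF assms(1)]
      by (intro sum.mono_neutral_right) auto
    finally show "fps_nth (\<Sum>s<N. fps_const (fps_nth a (Suc s)) * u ^ Suc s) n = fps_nth (a oo u) n"
      by (simp add: fps_compose_nth)
  qed
qed

theorem theorem5p1:
  shows "K_series = h_series oo (fps_X * (1 + g_hat_series)) \<and>
    (\<lambda>s. fps_const (h_seq (Suc s)) * fps_X ^ Suc s * (1 + g_hat_series) ^ Suc s) sums K_series \<and>
    M_series = K_series / (1 - K_series)"
proof -
  define u where "u = fps_X * (1 + g_hat_series)"
  define w where "w = 1 - fps_const (Av * Yv) * u"
  have u0: "fps_nth u 0 = 0" by (simp add: u_def)
  have "fps_nth w 0 = 1" by (simp add: w_def u0)
  then have w: "w \<noteq> 0" by auto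
  have "h_seq = (\<lambda>s. (Av * Yv) ^ (s - 1))" by (simp add: fun_eq_iff h_seq_def)
  then have K: "K_series * w = u"
    unfolding w_def u_def using K_series_nth NC_sum_eq_pointed_nc_sum
    by (intro shifted_power_series) (simp_all add: K_series_def)
  have M: "M_series * (1 - fps_const (1 + Av * Yv) * u) = u"
    unfolding u_def using M_series_nth NC_sum_eq_pointed_nc_sum
    by (intro shifted_power_series) (simp_all add: M_series_def)
  have "K_series * w = (h_series oo u) * w"
    using K h_series_compose[OF u0] by (simp add: w_def)
  then have K_eq: "K_series = h_series oo u" using w by simp
  have "(\<lambda>s. fps_const (fps_nth h_series (Suc s)) * u ^ Suc s) sums K_series"
    unfolding K_eq by (rule fps_compose_sums[OF u0]) (simp add: h_series_def)
  then have sums: "(\<lambda>s. fps_const (h_seq (Suc s)) * fps_X ^ Suc s * (1 + g_hat_series) ^ Suc s) sums K_series"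
    by (simp add: h_series_def u_def power_mult_distrib mult.assoc del: power_Suc)
  \<comment> \<open>The denominators of M and K differ by u. Replacing u by K w turns M (w - u) = u
    into M (1 - K) w = K w, and w cancels.\<close>
  have "1 - fps_const (1 + Av * Yv) * u = w - u"
    by (simp add: w_def algebra_simps flip: fps_const_add)
  then have "M_series * (w - u) = u" using M by simp
  moreover have "M_series * (1 - K_series) * w = M_series * (w - K_series * w)"
    by (simp add: algebra_simps)
  ultimately have "M_series * (1 - K_series) * w = K_series * w"
    using K by simp
  then have "M_series * (1 - K_series) = K_series" using w by simp
  moreover have "fps_nth (1 - K_series) 0 = 1" by (simp add: K_series_def)
  then have "1 - K_series \<noteq> 0" by auto
  ultimately have "M_series = K_series / (1 - K_series)"
    by (metis nonzero_mult_div_cancel_right)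
  then show ?thesis using K_eq sums by (simp add: u_def)
qed

end
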